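(* Let $(\mathbb S,+,\cdot,0,1)$ be a commutative semiring, let $\Sigma,\Delta$ be ranked alphabets, let $G=(Q,\Sigma,F,P,\mathrm{wt})$ be a weighted tree automaton (WTA) over $\mathbb S$, and let $h\colon T_\Sigma\to T_\Delta$ be a nondeleting and nonerasing tree homomorphism. Then there exists an eq-restricted, positive, classic weighted tree grammar with constraints (WTGc) $G'$ over $\mathbb S$ with input alphabet $\Delta$ such that $G'=h(G)$ as weighted tree languages.
   Context: Trees: $\mathbb N=\{0,1,2,\dots\}$, $[k]=\{1,\dots,k\}$. A ranked alphabet $\Sigma$ is a finite set with a rank map $\mathrm{rk}\colon\Sigma\to\mathbb N$; $\Sigma_k=\mathrm{rk}^{-1}(k)$. $T_\Sigma(Z)$ is the smallest set containing $Z$ (disjoint from $\Sigma$) and $\sigma(t_1,\dots,t_k)$ for all $\sigma\in\Sigma_k$, $t_1,\dots,t_k\in T_\Sigma(Z)$; $T_\Sigma=T_\Sigma(\emptyset)$. Positions: $\mathrm{pos}(z)=\{\varepsilon\}$ for $z \in Z$ and $\mathrm{pos}(\sigma(t_1,\dots,t_k))=\{\varepsilon\}\cup\{iw\mid i\in[k],w\in\mathrm{pos}(t_i)\}$. $t(w)$, $t|_w$, $t[t']_w$ denote the label at $w$, the subtree at $w$, and the replacement of the subtree at $w$ by $t'$. $\mathrm{pos}_S(t)=\{w\in\mathrm{pos}(t)\mid t(w)\in S\}$. Variables: $X=\{x_i\mid i\in\mathbb N\}$, $X_k=\{x_1,\dots,x_k\}$; $\mathrm{var}(t)$ is the set of variables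 occurring in $t$; $c[t_1,\dots,t_k]$ is substitution of $t_i$ for $x_i$. $\widehat C_\Sigma(X_k)$ is the set of $c\in T_\Sigma(X_k)$ in which each of $x_1,\dots,x_k$ occurs exactly once and in the order $x_1\cdots x_k$ from left to right. Commutative semiring: $(\mathbb S,+,0)$ and $(\mathbb S,\cdot,1)$ are commutative monoids, $\cdot$ distributes over $+$, and $0\cdot s=0$. A weighted tree language over $\mathbb S$ is a map $A\colon T_\Sigma\to\mathbb S$, $t\mapsto A_t$. A WTGc over $\mathbb S$ is a tuple $G=(Q,\Sigma,F,P,\mathrm{wt})$ with a finite set $Q$ of nonterminals, final weights $F\in\mathbb S^Q$, a ranked alphabet $\Sigma$, a finite set $P$ of productions $(\ell,q,E,I)$, written $\ell\xrightarrow{E,I}q$, where $\ell\in T_\Sigma(Q)\setminus Q$, $q\in Q$, and $E,I\subseteq\mathbb N^*\times\mathbb N^*$ are finite (equality and inequality constraints), and $\mathrm{wt}\in\mathbb S^P$. A tree $t\in T_\Sigma$ satisfies $(v,v')$ if $v,v'\in\mathrm{pos}(t)$ and $t|_v=t|_{v'}$, otherwise it dissatisfies it. For sentential forms $\xi,\zeta\in T_\Sigma(Q)$, $\xi\Rightarrow^{p,w}_{G,t}\zeta$ holds for $p=\ell\xrightarrow{E,I}q$ and $w\in\mathrm{pos}(\xi)$ if $\xi|_w=\ell$, $\zeta=\xi[q]_w$, $t|_w$ satisfies all pairs in $E$ and dissatisfies all pairs in $I$. A complete left-most derivation for $t$ to $q$ is a sequence $d=(p_1,w_1)\cdots(p_n,w_n)$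 with $t\Rightarrow^{p_1,w_1}_{G,t}\xi_1\Rightarrow\cdots\Rightarrow^{p_n,w_n}_{G,t}\xi_n=q\in Q$ and $w_1\prec\cdots\prec w_n$, where $\preceq$ is the lexicographic order on $\mathbb N^*$ in which prefixes are larger (so $\varepsilon$ is largest). $D^q_G(t)$ is the set of these. $\mathrm{wt}_G(d)=\prod_i\mathrm{wt}(p_i)$. $G$ generates the weighted tree language $G_t=\sum_{q\in Q,\,d\in D_G^q(t)}F_q\cdot\mathrm{wt}_G(d)$. A production $\ell\xrightarrow{E,I}q$ is normalized if $\ell=\sigma(q_1,\dots,q_k)$ with $q_i\in Q$; positive if $I=\emptyset$; unconstrained if $E=I=\emptyset$; classic if $v,v'\in\mathrm{pos}_Q(\ell)$ for all $(v,v')\in E\cup I$. A WTGc is positive/classic if all its productions are; it is a WTA if all productions are normalized and unconstrained. Eq-restricted: a nonterminal $\bot$ is a sink nonterminal if $F_\bot=0$ and the productions with target $\bot$ are exactly $\sigma(\bot,\dots,\bot)\to\bot$ (unconstrained, weight $1$) for all $\sigma\in\Sigma$. Each production is uniquely written $c[q_1,\dots,q_k]\xrightarrow{E,I}q$ with $c\in\widehat C_\Sigma(X_k)$, $q_i\in Q$; let $c(E)=\{(i,j)\in[k]^2\mid (v,v')\in E,\ c(v)=x_i,\ c(v')=x_j\}$ and $\equiv_{c(E)}$ be the smallest equivalence relation on $[k]$ containing it. A classic WTGc is eq-restricted if there is a sink nonterminal $\bot\in Q$ such that for every production $c[q_1,\dots,q_k]\xrightarrow{E,I}q$ and every $i\in[k]$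 there is $q'\in Q$ with (1) $\{q_j\mid j\in[i]_{\equiv_{c(E)}}\}\subseteq\{q',\bot\}$ and (2) exactly one $j\in[i]_{\equiv_{c(E)}}$ has $q_j=q'$. Tree homomorphism: given $h_\sigma\in T_\Delta(X_k)$ for every $\sigma\in\Sigma_k$, the induced map $h\colon T_\Sigma\to T_\Delta$ is $h(\sigma(t_1,\dots,t_k))=h_\sigma[h(t_1),\dots,h(t_k)]$. It is nonerasing if $h_\sigma\notin X$ for all $\sigma$, and nondeleting if $\mathrm{var}(h_\sigma)=X_k$ for all $\sigma\in\Sigma_k$. In that case each $h^{-1}(u)$ is finite, and for $A\in\mathbb S^{T_\Sigma}$ one defines $h(A)\in\mathbb S^{T_\Delta}$ by $h(A)_u=\sum_{t\in h^{-1}(u)}A_t$. *)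

theory Defs
  imports Main
begin

section \<open>Trees over ranked alphabets\<close>

record 'f ranked =
  symbols :: "'f set"
  rank :: "'f \<Rightarrow> nat"

definition ranked_alphabet :: "'f ranked \<Rightarrow> bool" where
  "ranked_alphabet \<Sigma> \<longleftrightarrow> finite (symbols \<Sigma>)"

datatype (funs: 'f, vars: 'v) tree = Var 'v | Fun 'f "('f, 'v) tree list"

text \<open>\<open>trees \<Sigma> Z\<close> is \<open>T\<^sub>\<Sigma>(Z)\<close>. The set \<open>T\<^sub>\<Sigma>\<close> of ground trees is \<open>trees \<Sigma> {}\<close>, whatever the
  type of the leaves; thus ground trees are also sentential forms of any grammar.\<close>

inductive_set trees :: "'f ranked \<Rightarrow> 'v set \<Rightarrow> ('f, 'v) tree set" for \<Sigma> Z where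
  Var: "z \<in> Z \<Longrightarrow> Var z \<in> trees \<Sigma> Z"
| Fun: "f \<in> symbols \<Sigma> \<Longrightarrow> length ts = rank \<Sigma> f \<Longrightarrow> \<forall>t\<in>set ts. t \<in> trees \<Sigma> Z
    \<Longrightarrow> Fun f ts \<in> trees \<Sigma> Z"

text \<open>Positions are words over the natural numbers; children are numbered from 1.\<close>

type_synonym pos = "nat list"

lemma size_nth_pred [termination_simp]:
  assumes "Suc 0 \<le> i" "i \<le> length ts"
  shows "size (ts ! (i - Suc 0)) < Suc (size_list size ts)"
proof -
  have "ts ! (i - Suc 0) \<in> set ts" using assms by simp
  then have "size (ts ! (i - Suc 0)) \<le> size_list size ts"
    by (rule size_list_estimation') simp
  then show ?thesis by simp
qed

fun positions :: "('f, 'v) tree \<Rightarrow> pos set" where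
  "positions (Var z) = {[]}"
| "positions (Fun f ts) = {[]} \<union> (\<Union>i\<in>{1..length ts}. (\<lambda>w. i # w) ` positions (ts ! (i - 1)))"

text \<open>Subtree, label and replacement at \<open>w\<close> are meaningful only for positions \<open>w\<close> of the tree.\<close>

fun subtree :: "('f, 'v) tree \<Rightarrow> pos \<Rightarrow> ('f, 'v) tree" where
  "subtree t [] = t"
| "subtree (Fun f ts) (i # w) = subtree (ts ! (i - 1)) w"
| "subtree (Var z) (i # w) = undefined"

definition label :: "('f, 'v) tree \<Rightarrow> pos \<Rightarrow> 'f + 'v" where
  "label t w = (case subtree t w of Var z \<Rightarrow> Inr z | Fun f ts \<Rightarrow> Inl f)"

fun replace_at :: "('f, 'v) tree \<Rightarrow> pos \<Rightarrow> ('f, 'v) tree \<Rightarrow> ('f, 'v) tree" where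
  "replace_at t [] s = s"
| "replace_at (Fun f ts) (i # w) s = Fun f (ts[i - 1 := replace_at (ts ! (i - 1)) w s])"
| "replace_at (Var z) (i # w) s = undefined"

definition positions_of :: "('f + 'v) set \<Rightarrow> ('f, 'v) tree \<Rightarrow> pos set" where
  "positions_of S t = {w \<in> positions t. label t w \<in> S}"

primrec subst_tree :: "('v \<Rightarrow> ('f, 'w) tree) \<Rightarrow> ('f, 'v) tree \<Rightarrow> ('f, 'w) tree" where
  "subst_tree \<theta> (Var z) = \<theta> z"
| "subst_tree \<theta> (Fun f ts) = Fun f (map (subst_tree \<theta>) ts)"

text \<open>The variable \<open>x\<^sub>i\<close> is \<open>Var i\<close> with \<open>i :: nat\<close>, so \<open>X\<^sub>k\<close> is \<open>{1..k}\<close>, and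
  \<open>fill c [t\<^sub>1, \<dots>, t\<^sub>k]\<close> is \<open>c[t\<^sub>1, \<dots>, t\<^sub>k]\<close>.\<close>

definition fill :: "('f, nat) tree \<Rightarrow> ('f, 'v) tree list \<Rightarrow> ('f, 'v) tree" where
  "fill c ts = subst_tree (\<lambda>i. ts ! (i - 1)) c"

primrec yield :: "('f, 'v) tree \<Rightarrow> 'v list" where
  "yield (Var z) = [z]"
| "yield (Fun f ts) = concat (map yield ts)"

text \<open>\<open>contexts \<Sigma> k\<close> is the set of trees over \<open>X\<^sub>k\<close> whose variables, read from left to right,
  are exactly \<open>x\<^sub>1, \<dots>, x\<^sub>k\<close>.\<close>

definition contexts :: "'f ranked \<Rightarrow> nat \<Rightarrow> ('f, nat) tree set" where
  "contexts \<Sigma> k = {c \<in> trees \<Sigma> {1..k}. yield c = [1..<Suc k]}"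


section \<open>Weighted tree grammars with constraints\<close>

type_synonym constraints = "(pos \<times> pos) set"

datatype ('f, 'q) production =
  Production (lhs: "('f, 'q) tree") (target: 'q) (eqs: constraints) (ineqs: constraints)

record ('q, 'f, 's) wtgc =
  nonterminals :: "'q set"
  alphabet :: "'f ranked"
  final :: "'q \<Rightarrow> 's"
  productions :: "('f, 'q) production set"
  wt :: "('f, 'q) production \<Rightarrow> 's"

text \<open>Only the values of \<open>final G\<close> on nonterminals and of \<open>wt G\<close> on productions of \<open>G\<close> matter.\<close>

definition is_wtgc :: "('q, 'f, 's) wtgc \<Rightarrow> bool" where
  "is_wtgc G \<longleftrightarrow>
     finite (nonterminals G) \<and> ranked_alphabet (alphabet G) \<and> finite (productions G) \<and>
     (\<forall>p\<in>productions G.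
        lhs p \<in> trees (alphabet G) (nonterminals G) - Var ` nonterminals G \<and>
        target p \<in> nonterminals G \<and> finite (eqs p) \<and> finite (ineqs p))"

definition satisfies :: "('f, 'v) tree \<Rightarrow> pos \<times> pos \<Rightarrow> bool" where
  "satisfies t = (\<lambda>(v, v'). v \<in> positions t \<and> v' \<in> positions t \<and> subtree t v = subtree t v')"

text \<open>\<open>step G t p w \<xi> \<zeta>\<close>: the constraints are evaluated on the input tree \<open>t\<close>, not on \<open>\<xi>\<close>.\<close>

definition step :: "('q, 'f, 's) wtgc \<Rightarrow> ('f, 'q) tree \<Rightarrow> ('f, 'q) production \<Rightarrow> pos
    \<Rightarrow> ('f, 'q) tree \<Rightarrow> ('f, 'q) tree \<Rightarrow> bool" where
  "step G t p w \<xi> \<zeta> \<longleftrightarrow>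
     p \<in> productions G \<and> w \<in> positions \<xi> \<and> subtree \<xi> w = lhs p \<and>
     \<zeta> = replace_at \<xi> w (Var (target p)) \<and>
     (\<forall>e\<in>eqs p. satisfies (subtree t w) e) \<and> (\<forall>e\<in>ineqs p. \<not> satisfies (subtree t w) e)"

fun derives :: "('q, 'f, 's) wtgc \<Rightarrow> ('f, 'q) tree \<Rightarrow> ('f, 'q) tree
    \<Rightarrow> (('f, 'q) production \<times> pos) list \<Rightarrow> ('f, 'q) tree \<Rightarrow> bool" where
  "derives G t \<xi> [] \<zeta> \<longleftrightarrow> \<xi> = \<zeta>"
| "derives G t \<xi> ((p, w) # d) \<zeta> \<longleftrightarrow> (\<exists>\<xi>'. step G t p w \<xi> \<xi>' \<and> derives G t \<xi>' d \<zeta>)"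

text \<open>The strict lexicographic order on positions in which proper prefixes are larger.\<close>

definition pos_less :: "pos \<Rightarrow> pos \<Rightarrow> bool" where
  "pos_less u v \<longleftrightarrow>
     (\<exists>r. r \<noteq> [] \<and> u = v @ r) \<or>
     (\<exists>x i j y z. i < j \<and> u = x @ i # y \<and> v = x @ j # z)"

definition derivations :: "('q, 'f, 's) wtgc \<Rightarrow> 'q \<Rightarrow> ('f, 'q) tree
    \<Rightarrow> (('f, 'q) production \<times> pos) list set" where
  "derivations G q t = {d. derives G t t d (Var q) \<and> sorted_wrt pos_less (map snd d)}"

text \<open>The sort is that of commutative semirings in which \<open>0 = 1\<close> is not excluded, in contrast to
  the class \<open>comm_semiring_1\<close>.\<close>

definition wt_derivation :: "('q, 'f, 's :: {comm_semiring_0, comm_monoid_mult}) wtgc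
    \<Rightarrow> (('f, 'q) production \<times> pos) list \<Rightarrow> 's" where
  "wt_derivation G d = (\<Prod>(p, w)\<leftarrow>d. wt G p)"

definition generates :: "('q, 'f, 's :: {comm_semiring_0, comm_monoid_mult}) wtgc
    \<Rightarrow> ('f, 'q) tree \<Rightarrow> 's" where
  "generates G t =
     (\<Sum>q\<in>nonterminals G. \<Sum>d\<in>derivations G q t. final G q * wt_derivation G d)"

definition normalized :: "('q, 'f, 's) wtgc \<Rightarrow> ('f, 'q) production \<Rightarrow> bool" where
  "normalized G p \<longleftrightarrow> (\<exists>f qs. lhs p = Fun f (map Var qs) \<and> f \<in> symbols (alphabet G) \<and>
     length qs = rank (alphabet G) f \<and> set qs \<subseteq> nonterminals G)"

definition is_wta :: "('q, 'f, 's) wtgc \<Rightarrow> bool" where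
  "is_wta G \<longleftrightarrow> is_wtgc G \<and> (\<forall>p\<in>productions G. normalized G p \<and> eqs p = {} \<and> ineqs p = {})"

definition positive :: "('q, 'f, 's) wtgc \<Rightarrow> bool" where
  "positive G \<longleftrightarrow> (\<forall>p\<in>productions G. ineqs p = {})"

definition classic :: "('q, 'f, 's) wtgc \<Rightarrow> bool" where
  "classic G \<longleftrightarrow> (\<forall>p\<in>productions G. \<forall>(v, v')\<in>eqs p \<union> ineqs p.
     v \<in> positions_of (Inr ` nonterminals G) (lhs p) \<and>
     v' \<in> positions_of (Inr ` nonterminals G) (lhs p))"


section \<open>Eq-restricted grammars\<close>

definition sink :: "('q, 'f, 's :: {comm_semiring_0, comm_monoid_mult}) wtgc \<Rightarrow> 'q \<Rightarrow> bool" where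
  "sink G b \<longleftrightarrow> b \<in> nonterminals G \<and> final G b = 0 \<and>
     {p \<in> productions G. target p = b} =
       {Production (Fun f (replicate (rank (alphabet G) f) (Var b))) b {} {} |f.
          f \<in> symbols (alphabet G)} \<and>
     (\<forall>p\<in>productions G. target p = b \<longrightarrow> wt G p = 1)"

definition context_constraints :: "nat \<Rightarrow> ('f, nat) tree \<Rightarrow> constraints \<Rightarrow> (nat \<times> nat) set" where
  "context_constraints k c E = {(i, j) \<in> {1..k} \<times> {1..k}.
     \<exists>(v, v')\<in>E. v \<in> positions c \<and> v' \<in> positions c \<and> label c v = Inr i \<and> label c v' = Inr j}"

definition equiv_closure :: "'a set \<Rightarrow> ('a \<times> 'a) set \<Rightarrow> ('a \<times> 'a) set" where
  "equiv_closure A r = \<Inter> {R. equiv A R \<and> r \<subseteq> R}"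

text \<open>Every left-hand side is \<open>c[q\<^sub>1, \<dots>, q\<^sub>k]\<close> for exactly one \<open>k\<close>, one \<open>c \<in> contexts \<Sigma> k\<close> and one
  \<open>qs = [q\<^sub>1, \<dots>, q\<^sub>k]\<close>, so the quantification over these just names them. The list is 0-based:
  \<open>q\<^sub>j\<close> is \<open>qs ! (j - 1)\<close>.\<close>

definition eq_restricted :: "('q, 'f, 's :: {comm_semiring_0, comm_monoid_mult}) wtgc \<Rightarrow> bool" where
  "eq_restricted G \<longleftrightarrow> is_wtgc G \<and> classic G \<and>
     (\<exists>b. sink G b \<and>
       (\<forall>p\<in>productions G. \<forall>k. \<forall>c\<in>contexts (alphabet G) k. \<forall>qs.
          length qs = k \<and> set qs \<subseteq> nonterminals G \<and> lhs p = fill c (map Var qs) \<longrightarrow>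
          (\<forall>i\<in>{1..k}. \<exists>q'\<in>nonterminals G.
             let C = equiv_closure {1..k} (context_constraints k c (eqs p)) `` {i} in
               {qs ! (j - 1) |j. j \<in> C} \<subseteq> {q', b} \<and>
               (\<exists>!j. j \<in> C \<and> qs ! (j - 1) = q'))))"


section \<open>Tree homomorphisms\<close>

definition tree_hom :: "'f ranked \<Rightarrow> 'd ranked \<Rightarrow> ('f \<Rightarrow> ('d, nat) tree) \<Rightarrow> bool" where
  "tree_hom \<Sigma> \<Delta> h \<longleftrightarrow> (\<forall>f\<in>symbols \<Sigma>. h f \<in> trees \<Delta> {1..rank \<Sigma> f})"

definition nonerasing :: "'f ranked \<Rightarrow> ('f \<Rightarrow> ('d, nat) tree) \<Rightarrow> bool" where
  "nonerasing \<Sigma> h \<longleftrightarrow> (\<forall>f\<in>symbols \<Sigma>. h f \<notin> range Var)"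

definition nondeleting :: "'f ranked \<Rightarrow> ('f \<Rightarrow> ('d, nat) tree) \<Rightarrow> bool" where
  "nondeleting \<Sigma> h \<longleftrightarrow> (\<forall>f\<in>symbols \<Sigma>. vars (h f) = {1..rank \<Sigma> f})"

text \<open>The map induced on ground trees; it is left unspecified on leaves \<open>Var z\<close>.\<close>

primrec apply_hom :: "('f \<Rightarrow> ('d, nat) tree) \<Rightarrow> ('f, 'v) tree \<Rightarrow> ('d, 'w) tree" where
  "apply_hom h (Fun f ts) = fill (h f) (map (apply_hom h) ts)"

text \<open>The sum is meant for nondeleting and nonerasing \<open>h\<close>, for which it is finite.\<close>

definition hom_image :: "'f ranked \<Rightarrow> ('f \<Rightarrow> ('d, nat) tree)
    \<Rightarrow> (('f, 'v) tree \<Rightarrow> 's :: comm_monoid_add) \<Rightarrow> ('d, 'w) tree \<Rightarrow> 's" where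
  "hom_image \<Sigma> h A u = (\<Sum>t | t \<in> trees \<Sigma> {} \<and> apply_hom h t = u. A t)"

end

theory Submission
  imports Defs
begin

text \<open>Every production \<open>\<sigma>(q\<^sub>1, \<dots>, q\<^sub>k) \<rightarrow> q\<close> of \<open>G\<close> becomes a production whose left-hand side is \<open>h \<sigma>\<close>
  with one chosen occurrence of each \<open>x\<^sub>i\<close> replaced by \<open>q\<^sub>i\<close> and all other occurrences replaced by the
  sink; equality constraints force all occurrences of the same \<open>x\<^sub>i\<close> to carry equal subtrees.
  Productions of \<open>G\<close> with the same image are merged by adding their weights. Splitting off the last
  step and distributing the remaining steps over the children gives a recursion for the total weight
  of the derivations from a tree to a sentential form. Since the sink contributes the factor \<open>1\<close>, this
  recursion shows, by induction on the size of \<open>u\<close>, that the weight of \<open>u\<close> at \<open>q\<close> in the new grammar is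
  the sum of the weights at \<open>q\<close> in \<open>G\<close> of all \<open>t\<close> with \<open>h t = u\<close>.\<close>

section \<open>Lists and positions\<close>

text \<open>The Cartesian product of \<open>A 0\<close>, ..., \<open>A (n - 1)\<close>, with tuples
  encoded as lists so that they can serve as lists of children or of derivations.\<close>

definition lists_in :: "nat \<Rightarrow> (nat \<Rightarrow> 'a set) \<Rightarrow> 'a list set" where
  "lists_in n A = {xs. length xs = n \<and> (\<forall>i<n. xs ! i \<in> A i)}"

lemma lists_in_0 [simp]: "lists_in 0 A = {[]}"
  by (auto simp: lists_in_def)

lemma lists_in_Suc: "lists_in (Suc n) A = (\<lambda>(xs, x). xs @ [x]) ` (lists_in n A \<times> A n)"
proof
  show "lists_in (Suc n) A \<subseteq> (\<lambda>(xs, x). xs @ [x]) ` (lists_in n A \<times> A n)"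
  proof
    fix ys assume "ys \<in> lists_in (Suc n) A"
    then have ys: "length ys = Suc n" "\<And>i. i < Suc n \<Longrightarrow> ys ! i \<in> A i"
      by (auto simp: lists_in_def)
    then obtain xs x where "ys = xs @ [x]" by (metis length_Suc_conv_rev)
    moreover have "xs \<in> lists_in n A"
      unfolding lists_in_def using ys calculation
      by (auto simp: nth_append) (metis less_SucI)
    moreover have "x \<in> A n" using ys calculation by (metis nth_append_length length_append_singleton nat.inject lessI)
    ultimately show "ys \<in> (\<lambda>(xs, x). xs @ [x]) ` (lists_in n A \<times> A n)" by force
  qed
  show "(\<lambda>(xs, x). xs @ [x]) ` (lists_in n A \<times> A n) \<subseteq> lists_in (Suc n) A"
    by (auto simp: lists_in_def nth_append less_Suc_eq)
qed

lemma finite_lists_in: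
  "(\<And>i. i < n \<Longrightarrow> finite (A i)) \<Longrightarrow> finite (lists_in n A)"
  by (induction n) (auto simp: lists_in_Suc)

text \<open>General distributivity: expanding the product picks one summand from each factor.
  Splitting off the last coordinate reduces the step to a product of two sums.\<close>

lemma prod_sum_lists_in:
  fixes f :: "nat \<Rightarrow> 'a \<Rightarrow> 's :: {comm_semiring_0, comm_monoid_mult}"
  shows "(\<Prod>i<n. \<Sum>x\<in>A i. f i x) = (\<Sum>xs\<in>lists_in n A. \<Prod>i<n. f i (xs ! i))"
proof (induction n)
  case (Suc n)
  have "(\<Sum>xs\<in>lists_in (Suc n) A. \<Prod>i<Suc n. f i (xs ! i)) =
      (\<Sum>(xs, x)\<in>lists_in n A \<times> A n. \<Prod>i<Suc n. f i ((xs @ [x]) ! i))"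
    unfolding lists_in_Suc
    by (subst sum.reindex) (auto simp: inj_on_def case_prod_unfold)
  also have "\<dots> = (\<Sum>(xs, x)\<in>lists_in n A \<times> A n. (\<Prod>i<n. f i (xs ! i)) * f n x)"
  proof (rule sum.cong, simp, clarsimp)
    fix xs x assume "xs \<in> lists_in n A"
    then have "length xs = n" by (simp add: lists_in_def)
    then show "(\<Prod>i<n. f i ((xs @ [x]) ! i)) * f n ((xs @ [x]) ! n) = (\<Prod>i<n. f i (xs ! i)) * f n x"
      by (auto simp: nth_append)
  qed
  also have "\<dots> = (\<Sum>xs\<in>lists_in n A. \<Prod>i<n. f i (xs ! i)) * (\<Sum>x\<in>A n. f n x)"
    by (simp add: sum_product sum.cartesian_product)
  finally show ?case by (simp add: Suc.IH)
qed simp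

text \<open>In a sorted list the entries of each key form a block, and the blocks come in key order.
  In the application the key is the child in which a derivation step acts.\<close>

lemma sorted_eq_concat_filter:
  assumes "sorted (map k xs)" and "\<forall>x\<in>set xs. k x < n"
  shows "concat (map (\<lambda>i. filter (\<lambda>x. k x = i) xs) [0..<n]) = xs"
proof -
  have "filter (\<lambda>x. k x < m) xs = concat (map (\<lambda>i. filter (\<lambda>x. k x = i) xs) [0..<m])" for m
  proof (induction m)
    case (Suc m)
    have "filter (\<lambda>x. k x < Suc m) xs = filter (\<lambda>x. k x < m) xs @ filter (\<lambda>x. k x = m) xs"
      using assms(1)
    proof (induction xs)
      case (Cons y ys)
      then have *: "\<forall>z\<in>set ys. k y \<le> k z" by simp
      \<comment> \<open>A head with key \<open>m\<close> cannot be followed by a smaller key, so it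
        rightly opens the second block.\<close>
      have "filter (\<lambda>x. k x < m) ys = []" if "k y = m"
        using * that by (auto simp: filter_empty_conv)
      then show ?case using Cons by auto
    qed simp
    then show ?case by (simp add: Suc.IH)
  qed simp
  from this[of n] show ?thesis using assms(2) by (simp add: filter_id_conv)
qed

section \<open>The left-most order on positions\<close>

lemma pos_less_Cons: "pos_less (i # u) (i # v) \<longleftrightarrow> pos_less u v"
proof
  assume "pos_less (i # u) (i # v)"
  then consider r where "r \<noteq> []" "i # u = i # v @ r"
    | x a b y z where "a < b" "i # u = x @ a # y" "i # v = x @ b # z"
    unfolding pos_less_def by auto
  then show "pos_less u v"
  proof cases
    case 2
    then show ?thesis unfolding pos_less_def by (cases x) auto
  qed (auto simp: pos_less_def)
next
  assume "pos_less u v"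
  then consider r where "r \<noteq> []" "u = v @ r"
    | x a b y z where "a < b" "u = x @ a # y" "v = x @ b # z"
    unfolding pos_less_def by auto
  then show "pos_less (i # u) (i # v)"
  proof cases
    case 2
    then have "i # u = (i # x) @ a # y" "i # v = (i # x) @ b # z" by auto
    then show ?thesis unfolding pos_less_def using 2(1) by blast
  qed (auto simp: pos_less_def)
qed

lemma pos_less_head: "i < j \<Longrightarrow> pos_less (i # u) (j # v)"
  unfolding pos_less_def by (metis append_Nil)

lemma pos_less_Nil: "w \<noteq> [] \<Longrightarrow> pos_less w []"
  unfolding pos_less_def by simp

text \<open>Below the root, positions are compared by their first letter first, so a left-most
  derivation finishes child after child. The root is excluded because it exceeds every other
  position.\<close>

lemma pos_less_hd_le:
  assumes "pos_less u v" "v \<noteq> []" shows "hd u \<le> hd v"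
  using assms(1) unfolding pos_less_def
proof (elim disjE exE conjE)
  fix x i j y z assume "i < j" "u = x @ i # y" "v = x @ j # z"
  then show ?thesis by (cases x) auto
qed (use assms(2) in auto)

section \<open>Total weight of derivations\<close>

text \<open>Extends \<open>derivations\<close> from nonterminals to arbitrary sentential forms,
  because removing the last step of a derivation leaves one that ends in a left-hand side.\<close>

definition derivs :: "('q, 'f, 's) wtgc \<Rightarrow> ('f, 'q) tree \<Rightarrow> ('f, 'q) tree
    \<Rightarrow> (('f, 'q) production \<times> pos) list set" where
  "derivs G t \<xi> = {d. derives G t t d \<xi> \<and> sorted_wrt pos_less (map snd d)}"

definition weight :: "('q, 'f, 's :: {comm_semiring_0, comm_monoid_mult}) wtgc
    \<Rightarrow> ('f, 'q) tree \<Rightarrow> ('f, 'q) tree \<Rightarrow> 's" where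
  "weight G t \<xi> = (\<Sum>d\<in>derivs G t \<xi>. wt_derivation G d)"

definition fulfils :: "('f, 'v) tree \<Rightarrow> ('f, 'q) production \<Rightarrow> bool" where
  "fulfils t p \<longleftrightarrow> (\<forall>e\<in>eqs p. satisfies t e) \<and> (\<forall>e\<in>ineqs p. \<not> satisfies t e)"

lemma generates_eq_weight:
  "generates G t = (\<Sum>q\<in>nonterminals G. final G q * weight G t (Var q))"
  by (simp add: generates_def weight_def derivs_def derivations_def sum_distrib_left)

lemma wt_derivation_append [simp]:
  "wt_derivation G (d @ d') = wt_derivation G d * wt_derivation G d'"
  by (simp add: wt_derivation_def)

lemma wt_derivation_Nil [simp]: "wt_derivation G [] = 1"
  by (simp add: wt_derivation_def)

section \<open>Splitting derivations at the root\<close>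

lemma lhs_not_Var:
  assumes "is_wtgc G" "p \<in> productions G" shows "lhs p \<noteq> Var z"
proof
  assume *: "lhs p = Var z"
  have "lhs p \<in> trees (alphabet G) (nonterminals G) - Var ` nonterminals G"
    using assms by (auto simp: is_wtgc_def)
  with * show False by (auto elim: trees.cases)
qed

lemma derives_append:
  "derives G t \<xi> (d @ d') \<zeta> \<longleftrightarrow> (\<exists>\<xi>'. derives G t \<xi> d \<xi>' \<and> derives G t \<xi>' d' \<zeta>)"
  by (induction G t \<xi> d \<zeta> rule: derives.induct) auto

lemma no_step_Var:
  assumes "is_wtgc G" shows "\<not> step G t p w (Var z) \<zeta>"
proof
  assume "step G t p w (Var z) \<zeta>"
  then have "p \<in> productions G" "lhs p = Var z" by (auto simp: step_def)
  then show False using lhs_not_Var[OF assms] by blast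
qed

lemma derives_Var: "is_wtgc G \<Longrightarrow> derives G t (Var z) d \<zeta> \<longleftrightarrow> d = [] \<and> \<zeta> = Var z"
  by (cases d) (auto simp: no_step_Var)

text \<open>A step at the root leaves a single nonterminal, which no production can rewrite any
  further.\<close>

lemma derives_Fun_nonroot:
  assumes "is_wtgc G" "derives G t \<xi> d (Fun g ss)"
  shows "[] \<notin> snd ` set d"
  using assms(2)
proof (induction d arbitrary: \<xi>)
  case (Cons a d)
  obtain p w where a: "a = (p, w)" by (cases a)
  from Cons.prems a obtain \<xi>' where s: "step G t p w \<xi> \<xi>'" "derives G t \<xi>' d (Fun g ss)" by auto
  have "w \<noteq> []"
  proof
    assume "w = []"
    then have "\<xi>' = Var (target p)" using s(1) by (simp add: step_def)
    then show False using s(2) derives_Var[OF assms(1)] by auto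
  qed
  then show ?case using Cons.IH[OF s(2)] a by auto
qed simp

text \<open>Only a step at the root can produce a bare nonterminal, and just before it the
  sentential form is the left-hand side. Conversely, the root is the largest position, so this step
  may be appended to any left-most derivation below the root.\<close>

lemma derivs_Var:
  assumes G: "is_wtgc G"
  shows "derivs G (Fun f ts) (Var q) =
    (\<lambda>(p, d). d @ [(p, [])]) ` (SIGMA p:{p\<in>productions G. target p = q \<and> fulfils (Fun f ts) p}.
       derivs G (Fun f ts) (lhs p))" (is "?L = ?R")
proof
  let ?t = "Fun f ts"
  show "?L \<subseteq> ?R"
  proof
    fix d assume "d \<in> ?L"
    then have d: "derives G ?t ?t d (Var q)" "sorted_wrt pos_less (map snd d)"
      by (auto simp: derivs_def)
    then have "d \<noteq> []" by auto
    then obtain d' p w where d': "d = d' @ [(p, w)]" by (metis rev_exhaust surj_pair)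
    with d obtain \<xi> where \<xi>: "derives G ?t ?t d' \<xi>" "step G ?t p w \<xi> (Var q)"
      by (auto simp: derives_append)
    have "w = []"
    proof (rule ccontr)
      assume "w \<noteq> []"
      then obtain i v where "w = i # v" by (cases w) auto
      with \<xi>(2) show False by (cases \<xi>) (auto simp: step_def)
    qed
    with \<xi> have "p \<in> productions G" "lhs p = \<xi>" "target p = q" "fulfils ?t p"
      by (auto simp: step_def fulfils_def)
    moreover have "d' \<in> derivs G ?t \<xi>"
      using \<xi>(1) d(2) d' by (auto simp: derivs_def sorted_wrt_append)
    ultimately show "d \<in> ?R" using d' \<open>w = []\<close> by force
  qed
  show "?R \<subseteq> ?L"
  proof
    fix d assume "d \<in> ?R"
    then obtain p d' where d: "d = d' @ [(p, [])]" and p: "p \<in> productions G" "target p = q"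
      "fulfils ?t p" and d': "derives G ?t ?t d' (lhs p)" "sorted_wrt pos_less (map snd d')"
      by (auto simp: derivs_def)
    obtain g ss where "lhs p = Fun g ss" using lhs_not_Var[OF G p(1)] by (cases "lhs p") auto
    then have "[] \<notin> snd ` set d'" using derives_Fun_nonroot[OF G] d'(1) by metis
    then have "sorted_wrt pos_less (map snd d)"
      using d'(2) d by (auto simp: sorted_wrt_append image_iff intro!: pos_less_Nil)
    moreover have "step G ?t p [] (lhs p) (Var q)"
      using p by (cases "lhs p") (auto simp: step_def fulfils_def)
    ultimately show "d \<in> ?L" using d d'(1) by (auto simp: derivs_def derives_append)
  qed
qed

text \<open>Since \<open>pos_less\<close> compares first the child and then the position inside it, a left-most derivation
  that never acts at the root is the concatenation of derivations for the children.\<close>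

definition shift :: "nat \<Rightarrow> ('p \<times> pos) list \<Rightarrow> ('p \<times> pos) list" where
  "shift i d = map (\<lambda>(p, w). (p, Suc i # w)) d"

text \<open>Undoes \<open>shift\<close>. Children are numbered from 1 in positions but from 0 in
  lists, hence \<open>Suc i\<close>.\<close>

definition component :: "nat \<Rightarrow> ('p \<times> pos) list \<Rightarrow> ('p \<times> pos) list" where
  "component i d = map (\<lambda>(p, w). (p, tl w)) (filter (\<lambda>(p, w). hd w = Suc i) d)"

text \<open>The blocks are concatenated, not shuffled: the left-most order exhausts one child before
  it enters the next.\<close>

definition interleave :: "('p \<times> pos) list list \<Rightarrow> ('p \<times> pos) list" where
  "interleave ds = concat (map (\<lambda>i. shift i (ds ! i)) [0..<length ds])"

lemma component_shift: "component i (shift j d) = (if i = j then d else [])"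
  by (induction d) (auto simp: component_def shift_def)

lemma component_append [simp]: "component i (d @ d') = component i d @ component i d'"
  by (simp add: component_def)

lemma component_interleave:
  assumes "i < length ds" shows "component i (interleave ds) = ds ! i"
proof -
  have "component i (concat (map (\<lambda>i. shift i (ds ! i)) [0..<m])) = (if i < m then ds ! i else [])"
    for m by (induction m) (auto simp: component_shift less_Suc_eq, simp_all add: component_def)
  with assms show ?thesis by (simp add: interleave_def)
qed

lemma wt_derivation_interleave:
  "wt_derivation G (interleave ds) = (\<Prod>i<length ds. wt_derivation G (ds ! i))"
proof -
  have *: "wt_derivation G (shift i d) = wt_derivation G d" for i d
    by (induction d) (auto simp: wt_derivation_def shift_def)
  have "wt_derivation G (concat (map (\<lambda>i. shift i (ds ! i)) [0..<m])) =
      (\<Prod>i<m. wt_derivation G (ds ! i))" for m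
    by (induction m) (auto simp: *)
  then show ?thesis by (simp add: interleave_def)
qed

lemma positions_Suc: "Suc i # w \<in> positions (Fun f ts) \<longleftrightarrow> i < length ts \<and> w \<in> positions (ts ! i)"
  by force

text \<open>Constraints are evaluated on the subtree at the rewritten position, and this subtree is
  the same whether reached from \<open>Fun f ts\<close> or from the child. Hence steps below the
  root are local to one child.\<close>

lemma step_Fun_Cons:
  assumes "length us = length ts"
  shows "step G (Fun f ts) p (a # v) (Fun g us) \<zeta> \<longleftrightarrow>
    (\<exists>i s. a = Suc i \<and> i < length ts \<and> step G (ts ! i) p v (us ! i) s \<and> \<zeta> = Fun g (us[i := s]))"
proof (cases a)
  case 0
  then show ?thesis by (auto simp: step_def)
next
  case (Suc i)
  then show ?thesis using assms by (auto simp: step_def positions_Suc simp del: positions.simps)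
qed

text \<open>Every step below the root changes one child and leaves the others alone. The induction
  consumes steps from the front, so the current children \<open>us\<close> must vary while
  \<open>ts\<close> stays fixed.\<close>

lemma derives_components:
  assumes "derives G (Fun f ts) (Fun g us) d \<zeta>" "[] \<notin> snd ` set d" "length us = length ts"
  shows "\<exists>ss. \<zeta> = Fun g ss \<and> length ss = length ts \<and>
    (\<forall>(p, w)\<in>set d. \<exists>i<length ts. hd w = Suc i) \<and>
    (\<forall>i<length ts. derives G (ts ! i) (us ! i) (component i d) (ss ! i))"
  using assms
proof (induction d arbitrary: us)
  case Nil
  then show ?case by (auto simp: component_def)
next
  case (Cons a d)
  obtain p b v where a: "a = (p, b # v)" using Cons.prems(2) by (cases a; cases "snd a") auto
  with Cons.prems obtain \<xi> where \<xi>: "step G (Fun f ts) p (b # v) (Fun g us) \<xi>"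
    "derives G (Fun f ts) \<xi> d \<zeta>" by auto
  then obtain i s where i: "b = Suc i" "i < length ts" "step G (ts ! i) p v (us ! i) s"
    "\<xi> = Fun g (us[i := s])" using step_Fun_Cons Cons.prems(3) by metis
  obtain ss where ss: "\<zeta> = Fun g ss" "length ss = length ts"
    "\<forall>(p, w)\<in>set d. \<exists>i<length ts. hd w = Suc i"
    "\<forall>j<length ts. derives G (ts ! j) (us[i := s] ! j) (component j d) (ss ! j)"
    using Cons.IH[of "us[i := s]"] \<xi>(2) i Cons.prems by auto
  have "derives G (ts ! j) (us ! j) (component j (a # d)) (ss ! j)" if "j < length ts" for j
    using ss(4)[rule_format, OF that] i a Cons.prems(3) that
    by (cases "j = i") (auto simp: component_def)
  then show ?case using ss a i by auto
qed

lemma derives_shift: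
  assumes "derives G (ts ! i) (us ! i) d s" "i < length ts" "length us = length ts"
  shows "derives G (Fun f ts) (Fun g us) (shift i d) (Fun g (us[i := s]))"
  using assms
proof (induction d arbitrary: us)
  case (Cons a d)
  obtain p v where a: "a = (p, v)" by (cases a)
  then obtain s' where s': "step G (ts ! i) p v (us ! i) s'" "derives G (ts ! i) s' d s"
    using Cons.prems by auto
  have "derives G (Fun f ts) (Fun g (us[i := s'])) (shift i d) (Fun g (us[i := s', i := s]))"
    using Cons.IH[of "us[i := s']"] s' Cons.prems by auto
  then show ?case using s' a Cons.prems by (auto simp: shift_def step_Fun_Cons)
qed (auto simp: shift_def)

lemma derives_interleave:
  assumes "length us = length ts" "length ss = length ts" "length ds = length ts"
    and "\<And>i. i < length ts \<Longrightarrow> derives G (ts ! i) (us ! i) (ds ! i) (ss ! i)"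
  shows "derives G (Fun f ts) (Fun g us) (interleave ds) (Fun g ss)"
proof -
  \<comment> \<open>Invariant: after \<open>m\<close> blocks the first \<open>m\<close> children are
    finished and the remaining ones are untouched.\<close>
  have "derives G (Fun f ts) (Fun g us) (concat (map (\<lambda>i. shift i (ds ! i)) [0..<m]))
      (Fun g (take m ss @ drop m us))" if "m \<le> length ts" for m
    using that
  proof (induction m)
    case (Suc m)
    let ?us = "take m ss @ drop m us"
    have m: "m < length ts" using Suc.prems by simp
    have "?us ! m = us ! m" using m assms by (simp add: nth_append)
    then have "derives G (Fun f ts) (Fun g ?us) (shift m (ds ! m)) (Fun g (?us[m := ss ! m]))"
      using m assms by (intro derives_shift) auto
    moreover have "?us[m := ss ! m] = take (Suc m) ss @ drop (Suc m) us"
      using m assms by (simp add: take_Suc_conv_app_nth list_update_append Cons_nth_drop_Suc[symmetric])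
    ultimately show ?case using Suc by (auto simp: derives_append)
  qed simp
  from this[of "length ts"] show ?thesis using assms by (simp add: interleave_def)
qed

lemma sorted_interleave:
  assumes "\<And>d. d \<in> set ds \<Longrightarrow> sorted_wrt pos_less (map snd d)"
  shows "sorted_wrt pos_less (map snd (interleave ds))"
proof -
  have *: "sorted_wrt pos_less (map snd (shift i d))" if "sorted_wrt pos_less (map snd d)"
    for i and d :: "('p \<times> pos) list"
    using that by (auto simp: shift_def sorted_wrt_map case_prod_unfold pos_less_Cons)
  have "sorted_wrt pos_less (map snd (concat (map (\<lambda>i. shift i (ds ! i)) [0..<m])))"
    if "m \<le> length ds" for m
    using that
  proof (induction m)
    case (Suc m)
    then have "sorted_wrt pos_less (map snd (shift m (ds ! m)))"
      using assms by (intro *) auto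
    moreover have "pos_less (snd x) (snd y)" if "x \<in> set (concat (map (\<lambda>i. shift i (ds ! i)) [0..<m]))"
      "y \<in> set (shift m (ds ! m))" for x y
      using that by (auto simp: shift_def intro!: pos_less_head)
    ultimately show ?case using Suc by (auto simp: sorted_wrt_append)
  qed simp
  then show ?thesis by (simp add: interleave_def)
qed

lemma interleave_components:
  assumes "sorted_wrt pos_less (map snd d)" "[] \<notin> snd ` set d"
    and "\<forall>(p, w)\<in>set d. \<exists>i<n. hd w = Suc i"
  shows "interleave (map (\<lambda>i. component i d) [0..<n]) = d"
proof -
  \<comment> \<open>The sort key is the list index of the child; \<open>hd\<close> is meaningful
    because no step acts at the root.\<close>
  let ?k = "\<lambda>(p, w). hd w - 1"
  have shift: "shift i (component i d) = filter (\<lambda>x. ?k x = i) d" for i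
    using assms(2,3)
  proof (induction d)
    case (Cons a d)
    obtain p b v where a: "a = (p, b # v)" using Cons.prems(1) by (cases a; cases "snd a") auto
    then show ?case using Cons by (auto simp: shift_def component_def)
  qed (auto simp: shift_def component_def)
  have "sorted_wrt (\<lambda>x y. ?k x \<le> ?k y) d"
    by (rule sorted_wrt_mono_rel[of _ "\<lambda>x y. pos_less (snd x) (snd y)"])
      (use assms(1,2) in \<open>force simp: sorted_wrt_map intro!: diff_le_mono pos_less_hd_le\<close>)+
  then have "sorted (map ?k d)" by (simp add: sorted_wrt_map)
  moreover have "\<forall>x\<in>set d. ?k x < n" using assms(3) by auto
  ultimately have "concat (map (\<lambda>i. filter (\<lambda>x. ?k x = i) d) [0..<n]) = d"
    by (rule sorted_eq_concat_filter)
  moreover have "map (\<lambda>i. shift i (map (\<lambda>i. component i d) [0..<n] ! i)) [0..<n] =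
      map (\<lambda>i. filter (\<lambda>x. ?k x = i) d) [0..<n]"
    using shift by auto
  ultimately show ?thesis
    by (simp only: interleave_def length_map length_upt diff_zero)
qed

text \<open>Steps in different children do not influence each other, and the left-most order admits
  only one way to merge derivations of the children. The inverse map collects the steps of each
  child.\<close>

lemma derivs_Fun:
  assumes G: "is_wtgc G" and len: "length ss = length ts"
  shows "bij_betw interleave (lists_in (length ts) (\<lambda>i. derivs G (ts ! i) (ss ! i)))
    (derivs G (Fun f ts) (Fun f ss))"
proof (rule bij_betw_byWitness[where f' = "\<lambda>d. map (\<lambda>i. component i d) [0..<length ts]"])
  let ?n = "length ts"
  have comps: "[] \<notin> snd ` set d" "\<forall>(p, w)\<in>set d. \<exists>i<?n. hd w = Suc i"
    "\<forall>i<?n. derives G (ts ! i) (ts ! i) (component i d) (ss ! i)"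
    "sorted_wrt pos_less (map snd d)"
    if "d \<in> derivs G (Fun f ts) (Fun f ss)" for d
  proof -
    have d: "derives G (Fun f ts) (Fun f ts) d (Fun f ss)" "sorted_wrt pos_less (map snd d)"
      using that by (auto simp: derivs_def)
    show "[] \<notin> snd ` set d" using derives_Fun_nonroot[OF G d(1)] .
    from derives_components[OF d(1) this refl]
    show "\<forall>(p, w)\<in>set d. \<exists>i<?n. hd w = Suc i"
      "\<forall>i<?n. derives G (ts ! i) (ts ! i) (component i d) (ss ! i)" by auto
    show "sorted_wrt pos_less (map snd d)" by fact
  qed
  show "\<forall>ds\<in>lists_in ?n (\<lambda>i. derivs G (ts ! i) (ss ! i)).
      map (\<lambda>i. component i (interleave ds)) [0..<?n] = ds"
    by (auto simp: lists_in_def component_interleave intro!: nth_equalityI)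
  show "\<forall>d\<in>derivs G (Fun f ts) (Fun f ss). interleave (map (\<lambda>i. component i d) [0..<?n]) = d"
  proof
    fix d assume "d \<in> derivs G (Fun f ts) (Fun f ss)"
    from interleave_components[OF comps(4,1,2)[OF this]]
    show "interleave (map (\<lambda>i. component i d) [0..<?n]) = d" .
  qed
  show "interleave ` lists_in ?n (\<lambda>i. derivs G (ts ! i) (ss ! i)) \<subseteq> derivs G (Fun f ts) (Fun f ss)"
    using len by (auto simp: lists_in_def derivs_def in_set_conv_nth
        intro!: derives_interleave sorted_interleave)
  show "(\<lambda>d. map (\<lambda>i. component i d) [0..<?n]) ` derivs G (Fun f ts) (Fun f ss) \<subseteq>
      lists_in ?n (\<lambda>i. derivs G (ts ! i) (ss ! i))"
  proof clarify
    fix d assume d: "d \<in> derivs G (Fun f ts) (Fun f ss)"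
    have "sorted_wrt pos_less (map snd (component i d))" for i
      using comps(4,1)[OF d]
    proof (induction d)
      case (Cons a d)
      obtain p b v where a: "a = (p, b # v)" using Cons.prems(2) by (cases a; cases "snd a") auto
      \<comment> \<open>Both steps lie in the same child, so comparing their positions amounts to
        comparing the tails.\<close>
      have "pos_less v w" if "(p', w) \<in> set (component i d)" "b = Suc i" for p' w
      proof -
        from that obtain w' where w': "(p', w') \<in> set d" "hd w' = Suc i" "w = tl w'"
          by (auto simp: component_def)
        then have "w' \<noteq> []" using Cons.prems(2) by force
        then have "w' = b # w" using w' that by (cases w') auto
        then have "pos_less (b # v) (b # w)" using Cons.prems(1) a w'(1) by force
        then show ?thesis by (simp add: pos_less_Cons)
      qed
      moreover have "component i (a # d) = (if b = Suc i then [(p, v)] else []) @ component i d"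
        using a by (simp add: component_def)
      ultimately show ?case using Cons by auto
    qed (simp add: component_def)
    then show "map (\<lambda>i. component i d) [0..<?n] \<in> lists_in ?n (\<lambda>i. derivs G (ts ! i) (ss ! i))"
      using comps(3)[OF d] by (auto simp: lists_in_def derivs_def)
  qed
qed

lemma derivs_Fun_empty:
  assumes G: "is_wtgc G" and "\<not> (f = g \<and> length ss = length ts)"
  shows "derivs G (Fun f ts) (Fun g ss) = {}"
proof (rule equals0I)
  fix d assume "d \<in> derivs G (Fun f ts) (Fun g ss)"
  then have d: "derives G (Fun f ts) (Fun f ts) d (Fun g ss)" by (simp add: derivs_def)
  from derives_components[OF d derives_Fun_nonroot[OF G d] refl] assms(2) show False by auto
qed

section \<open>Finiteness and the recursion for total weights\<close>

lemma finite_derivs: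
  assumes G: "is_wtgc G" and "vars t = {}"
  shows "finite (derivs G t \<xi>)"
  using assms(2)
proof (induction t arbitrary: \<xi>)
  case (Fun f ts)
  \<comment> \<open>Targets with a root symbol come first: nonterminal targets reduce to left-hand
    sides, which have this form.\<close>
  have Fun_case: "finite (derivs G (Fun f ts) (Fun g ss))" for g ss
  proof (cases "f = g \<and> length ss = length ts")
    case True
    have "finite (lists_in (length ts) (\<lambda>i. derivs G (ts ! i) (ss ! i)))"
      using Fun by (intro finite_lists_in) auto
    then show ?thesis using derivs_Fun[OF G, of ss ts f] True bij_betw_finite by auto
  qed (simp add: derivs_Fun_empty[OF G])
  have "finite (derivs G (Fun f ts) (lhs p))" if "p \<in> productions G" for p
    using lhs_not_Var[OF G that] Fun_case by (cases "lhs p") auto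
  moreover have "finite (productions G)" using G by (simp add: is_wtgc_def)
  ultimately have "finite (derivs G (Fun f ts) (Var q))" for q
    unfolding derivs_Var[OF G] by (intro finite_imageI finite_SigmaI) auto
  then show ?case using Fun_case by (cases \<xi>) auto
qed simp

lemma weight_Var:
  assumes G: "is_wtgc G" and t: "vars t = {}"
  shows "weight G t (Var q) =
    (\<Sum>p | p \<in> productions G \<and> target p = q \<and> fulfils t p. wt G p * weight G t (lhs p))"
proof -
  let ?P = "{p \<in> productions G. target p = q \<and> fulfils t p}"
  obtain f ts where f: "t = Fun f ts" using t by (cases t) auto
  have fin: "finite (productions G)" using G by (simp add: is_wtgc_def)
  have "weight G t (Var q) =
      (\<Sum>(p, d)\<in>(SIGMA p:?P. derivs G t (lhs p)). wt_derivation G (d @ [(p, [])]))"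
    unfolding weight_def f derivs_Var[OF G]
    by (subst sum.reindex) (auto simp: inj_on_def case_prod_unfold)
  also have "\<dots> = (\<Sum>p\<in>?P. \<Sum>d\<in>derivs G t (lhs p). wt_derivation G (d @ [(p, [])]))"
    using fin finite_derivs[OF G t] by (simp add: sum.Sigma)
  also have "\<dots> = (\<Sum>p\<in>?P. wt G p * weight G t (lhs p))"
    by (simp add: weight_def wt_derivation_def sum_distrib_left mult.commute)
  finally show ?thesis .
qed

text \<open>Derivations correspond to tuples of derivations of the children, and their weights
  multiply; distributivity then factors the sum over tuples.\<close>

lemma weight_Fun:
  assumes G: "is_wtgc G"
  shows "weight G (Fun f ts) (Fun g ss) =
    (if f = g \<and> length ss = length ts then \<Prod>i<length ts. weight G (ts ! i) (ss ! i) else 0)"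
proof (cases "f = g \<and> length ss = length ts")
  case True
  have "weight G (Fun f ts) (Fun g ss) =
      (\<Sum>ds\<in>lists_in (length ts) (\<lambda>i. derivs G (ts ! i) (ss ! i)). wt_derivation G (interleave ds))"
    unfolding weight_def
    using sum.reindex_bij_betw[OF derivs_Fun[OF G, of ss ts f], of "wt_derivation G"] True by auto
  also have "\<dots> = (\<Sum>ds\<in>lists_in (length ts) (\<lambda>i. derivs G (ts ! i) (ss ! i)).
      \<Prod>i<length ts. wt_derivation G (ds ! i))"
    by (rule sum.cong) (auto simp: wt_derivation_interleave lists_in_def)
  also have "\<dots> = (\<Prod>i<length ts. weight G (ts ! i) (ss ! i))"
    by (simp add: weight_def prod_sum_lists_in)
  finally show ?thesis using True by simp
qed (auto simp: weight_def derivs_Fun_empty[OF G])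

section \<open>Leaves, substitution and preimages\<close>

lemma size_nth_less [termination_simp]:
  "i < length ts \<Longrightarrow> size (ts ! i) < Suc (size_list size ts)"
  using size_nth_pred[of "Suc i" ts] by simp

text \<open>The graph of the map from leaf positions to variables, so that products can run over
  occurrences instead of variables.\<close>

fun leaves :: "('f, 'v) tree \<Rightarrow> (pos \<times> 'v) set" where
  "leaves (Var z) = {([], z)}"
| "leaves (Fun f ts) = (\<Union>i\<in>{..<length ts}. (\<lambda>(w, x). (Suc i # w, x)) ` leaves (ts ! i))"

text \<open>The new label may depend on the position, so that occurrences of one variable can
  receive different nonterminals, which a substitution cannot achieve.\<close>

fun relabel :: "(pos \<Rightarrow> 'v \<Rightarrow> 'w) \<Rightarrow> ('f, 'v) tree \<Rightarrow> ('f, 'w) tree" where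
  "relabel g (Var z) = Var (g [] z)"
| "relabel g (Fun f ts) =
    Fun f (map (\<lambda>i. relabel (\<lambda>w. g (Suc i # w)) (ts ! i)) [0..<length ts])"

text \<open>\<open>fits t u\<close>: \<open>u\<close> is obtained from \<open>t\<close> by replacing leaves, where different occurrences of the same
  variable may be replaced by different trees.\<close>

fun fits :: "('f, 'v) tree \<Rightarrow> ('f, 'w) tree \<Rightarrow> bool" where
  "fits (Var z) u \<longleftrightarrow> True"
| "fits (Fun f ts) (Var z) \<longleftrightarrow> False"
| "fits (Fun f ts) (Fun g us) \<longleftrightarrow>
    f = g \<and> length ts = length us \<and> (\<forall>i<length ts. fits (ts ! i) (us ! i))"

lemma leaves_Fun:
  "(w, x) \<in> leaves (Fun f ts) \<longleftrightarrow> (\<exists>i<length ts. \<exists>v. w = Suc i # v \<and> (v, x) \<in> leaves (ts ! i))"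
  by force

lemma leaves_iff: "(w, x) \<in> leaves t \<longleftrightarrow> w \<in> positions t \<and> label t w = Inr x"
proof (induction t arbitrary: w)
  case (Fun f ts)
  consider "w = []" | v where "w = 0 # v" | i v where "w = Suc i # v"
    by (cases w rule: list.exhaust; cases "hd w") auto
  then show ?case
  proof cases
    case 3
    then show ?thesis using Fun[of "ts ! i" v]
      by (auto simp: label_def leaves_Fun positions_Suc simp del: positions.simps leaves.simps)
  qed (auto simp: label_def)
qed (auto simp: label_def)

lemma leaves_unique: "(w, x) \<in> leaves t \<Longrightarrow> (w, y) \<in> leaves t \<Longrightarrow> x = y"
  by (simp add: leaves_iff)

lemma finite_leaves: "finite (leaves t)"
  by (induction t) auto

lemma vars_iff_leaves: "x \<in> vars t \<longleftrightarrow> (\<exists>w. (w, x) \<in> leaves t)"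
proof (induction t)
  case (Fun f ts)
  have "x \<in> vars (Fun f ts) \<longleftrightarrow> (\<exists>i<length ts. x \<in> vars (ts ! i))"
    by simp (metis in_set_conv_nth)
  also have "\<dots> \<longleftrightarrow> (\<exists>i<length ts. \<exists>w. (w, x) \<in> leaves (ts ! i))"
    using Fun.IH[OF nth_mem] by auto
  finally show ?case by (auto simp: leaves_Fun simp del: leaves.simps)
qed simp

lemma leaves_relabel: "leaves (relabel g t) = (\<lambda>(w, x). (w, g w x)) ` leaves t"
  by (induction t arbitrary: g) (auto simp: image_UN image_image case_prod_unfold)

lemma leaves_subst_Var:
  assumes "\<And>x. x \<in> vars t \<Longrightarrow> \<theta> x = Var (r x)"
  shows "leaves (subst_tree \<theta> t) = (\<lambda>(w, x). (w, r x)) ` leaves t"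
  using assms
proof (induction t)
  case (Fun f ts)
  have "leaves (subst_tree \<theta> (ts ! i)) = (\<lambda>(w, x). (w, r x)) ` leaves (ts ! i)"
    if "i < length ts" for i
  proof (rule Fun.IH)
    fix x assume "x \<in> vars (ts ! i)"
    then show "\<theta> x = Var (r x)" using that by (intro Fun.prems) auto
  qed (use that in simp)
  then show ?case by (simp add: image_UN image_image case_prod_unfold)
qed simp

lemma Fun_in_trees_iff:
  "Fun f ts \<in> trees \<Sigma> Z \<longleftrightarrow>
    f \<in> symbols \<Sigma> \<and> length ts = rank \<Sigma> f \<and> (\<forall>t\<in>set ts. t \<in> trees \<Sigma> Z)"
  by (auto intro: trees.Fun elim: trees.cases)

lemma relabel_in_trees:
  assumes "t \<in> trees \<Sigma> X" "\<And>w x. (w, x) \<in> leaves t \<Longrightarrow> g w x \<in> Z"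
  shows "relabel g t \<in> trees \<Sigma> Z"
  using assms
proof (induction t arbitrary: g rule: tree.induct)
  case (Fun f ts)
  have "relabel (\<lambda>w. g (Suc i # w)) (ts ! i) \<in> trees \<Sigma> Z" if "i < length ts" for i
  proof (rule Fun.IH)
    show "ts ! i \<in> trees \<Sigma> X" using Fun.prems(1) that by (simp add: Fun_in_trees_iff)
    show "g (Suc i # w) x \<in> Z" if "(w, x) \<in> leaves (ts ! i)" for w x
      using that \<open>i < length ts\<close> by (intro Fun.prems(2)) (auto simp: leaves_Fun simp del: leaves.simps)
  qed (use that in simp)
  then show ?case using Fun.prems(1) by (auto simp: Fun_in_trees_iff)
qed (auto intro: trees.Var)

lemma set_yield: "set (yield t) = vars t"
  by (induction t) auto

lemma disjoint_of_distinct_concat: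
  assumes "distinct (concat xss)" "i < length xss" "j < length xss"
    "x \<in> set (xss ! i)" "x \<in> set (xss ! j)"
  shows "i = j"
  using assms
proof (induction xss arbitrary: i j)
  case (Cons xs xss)
  have "x \<notin> set (xss ! k)" if "x \<in> set xs" "k < length xss" for k
    using Cons.prems(1) that nth_mem[of k xss] by (auto simp: disjoint_iff)
  then show ?case using Cons by (cases i; cases j) auto
qed simp

text \<open>The yields of different children are disjoint, so two occurrences of \<open>x\<close>
  descend into the same child.\<close>

lemma leaves_inject:
  assumes "distinct (yield t)" "(w, x) \<in> leaves t" "(w', x) \<in> leaves t"
  shows "w = w'"
  using assms
proof (induction t arbitrary: w w')
  case (Fun f ts)
  obtain i v where i: "i < length ts" "w = Suc i # v" "(v, x) \<in> leaves (ts ! i)"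
    using Fun.prems(2) by auto
  obtain j v' where j: "j < length ts" "w' = Suc j # v'" "(v', x) \<in> leaves (ts ! j)"
    using Fun.prems(3) by auto
  have "i = j"
    by (rule disjoint_of_distinct_concat[of "map yield ts" _ _ x])
      (use Fun.prems(1) i j in \<open>auto simp: set_yield vars_iff_leaves\<close>)
  moreover have "distinct (yield (ts ! i))"
    using Fun.prems(1) i(1) by (auto simp: distinct_concat_iff)
  ultimately show ?case using Fun.IH[of "ts ! i" v v'] i j by auto
qed simp

lemma fits_subst: "fits t (subst_tree \<theta> t)"
  by (induction t) auto

lemma subtree_subst:
  assumes "(w, x) \<in> leaves t"
  shows "w \<in> positions (subst_tree \<theta> t)" "subtree (subst_tree \<theta> t) w = \<theta> x"
proof -
  have "w \<in> positions (subst_tree \<theta> t) \<and> subtree (subst_tree \<theta> t) w = \<theta> x"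
    using assms
  proof (induction t arbitrary: w)
    case (Fun f ts)
    then obtain i v where "i < length ts" "w = Suc i # v" "(v, x) \<in> leaves (ts ! i)"
      by (auto simp: leaves_Fun simp del: leaves.simps)
    then show ?case using Fun.IH[of "ts ! i" v] by (simp add: positions_Suc del: positions.simps)
  qed (cases "\<theta> x", auto)
  then show "w \<in> positions (subst_tree \<theta> t)" "subtree (subst_tree \<theta> t) w = \<theta> x" by auto
qed

text \<open>A converse to \<open>fits_subst\<close>: a fit fails to be a substitution instance only
  if occurrences of one variable disagree, which equality constraints will rule out.\<close>

lemma fits_imp_subst:
  assumes "fits t u" "\<And>w x. (w, x) \<in> leaves t \<Longrightarrow> subtree u w = \<theta> x"
  shows "u = subst_tree \<theta> t"
  using assms
proof (induction t arbitrary: u)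
  case (Var z)
  then show ?case by (metis leaves.simps(1) singletonI subst_tree.simps(1) subtree.simps(1))
next
  case (Fun f ts)
  obtain us where u: "u = Fun f us" "length us = length ts" "\<forall>i<length ts. fits (ts ! i) (us ! i)"
    using Fun.prems(1) by (cases u) auto
  have "us ! i = subst_tree \<theta> (ts ! i)" if "i < length ts" for i
  proof (rule Fun.IH)
    fix w x assume "(w, x) \<in> leaves (ts ! i)"
    then have "(Suc i # w, x) \<in> leaves (Fun f ts)" using that by force
    from Fun.prems(2)[OF this] show "subtree (us ! i) w = \<theta> x" using u by simp
  qed (use u that in auto)
  then show ?case using u by (auto intro: nth_equalityI)
qed

lemma subst_tree_inject:
  assumes "subst_tree \<theta> t = subst_tree \<theta>' t" "x \<in> vars t" shows "\<theta> x = \<theta>' x"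
  using assms by (metis subtree_subst(2) vars_iff_leaves)

lemma size_subst: "x \<in> vars t \<Longrightarrow> size (\<theta> x) \<le> size (subst_tree \<theta> t)"
proof (induction t)
  case (Fun f ts)
  then obtain t' where t': "t' \<in> set ts" "x \<in> vars t'" by auto
  have "size (\<theta> x) \<le> size_list (size \<circ> subst_tree \<theta>) ts"
    by (rule size_list_estimation'[OF t'(1)]) (simp add: Fun.IH t')
  then show ?case by simp
qed simp

text \<open>The root symbol of \<open>t\<close> adds one to the size. For nonerasing homomorphisms
  this makes the arguments smaller than the image, as the inductions on size require.\<close>

lemma size_subst_less:
  assumes "x \<in> vars t" "t \<notin> range Var" shows "size (\<theta> x) < size (subst_tree \<theta> t)"
proof (cases t)
  case (Fun f ts)
  then obtain t' where t': "t' \<in> set ts" "x \<in> vars t'" using assms by auto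
  have "size (\<theta> x) \<le> size_list (size \<circ> subst_tree \<theta>) ts"
    by (rule size_list_estimation'[OF t'(1)]) (simp add: size_subst t'(2))
  then show ?thesis using Fun by simp
qed (use assms in auto)

lemma subst_in_trees: "subst_tree \<theta> t \<in> trees \<Sigma> Z \<Longrightarrow> x \<in> vars t \<Longrightarrow> \<theta> x \<in> trees \<Sigma> Z"
proof (induction t)
  case (Fun f ts)
  from Fun.prems(1) have "\<forall>t\<in>set ts. subst_tree \<theta> t \<in> trees \<Sigma> Z"
    by (auto elim: trees.cases)
  then show ?case using Fun by auto
qed simp

lemma vars_trees: "t \<in> trees \<Sigma> Z \<Longrightarrow> vars t \<subseteq> Z"
  by (induction rule: trees.induct) auto

text \<open>Iterating \<open>weight_Fun\<close> down \<open>t\<close>, every inner node compares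
  symbols and every leaf contributes the weight of the subtree of \<open>u\<close> standing there; a
  single mismatch gives a factor 0.\<close>

lemma weight_relabel:
  assumes G: "is_wtgc G" and "vars u = {}"
  shows "weight G u (relabel g t) =
    (if fits t u then \<Prod>(w, x)\<in>leaves t. weight G (subtree u w) (Var (g w x)) else 0)"
  using assms(2)
proof (induction t arbitrary: u g)
  case (Fun f ts)
  obtain f' us where u: "u = Fun f' us" using Fun.prems by (cases u) auto
  show ?case
  proof (cases "f = f' \<and> length ts = length us")
    case True
    let ?A = "\<lambda>i. (\<lambda>(w, x). (Suc i # w, x)) ` leaves (ts ! i)"
    let ?W = "\<lambda>(w, x). weight G (subtree u w) (Var (g w x))"
    have IH: "weight G (us ! i) (relabel (\<lambda>w. g (Suc i # w)) (ts ! i)) =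
        (if fits (ts ! i) (us ! i) then prod ?W (?A i) else 0)" if i: "i < length us" for i
    proof -
      have "prod ?W (?A i) = (\<Prod>(w, x)\<in>leaves (ts ! i). weight G (subtree (us ! i) w) (Var (g (Suc i # w) x)))"
        by (subst prod.reindex) (auto simp: inj_on_def u case_prod_unfold)
      moreover have "vars (us ! i) = {}" using Fun.prems u i by auto
      ultimately show ?thesis using Fun.IH[of "ts ! i" "us ! i"] i True by simp
    qed
    have W: "weight G u (relabel g (Fun f ts)) =
        (\<Prod>i<length us. if fits (ts ! i) (us ! i) then prod ?W (?A i) else 0)"
      using True IH by (simp add: u weight_Fun[OF G])
    show ?thesis
    proof (cases "\<forall>i<length us. fits (ts ! i) (us ! i)")
      case fit: True
      have "weight G u (relabel g (Fun f ts)) = (\<Prod>i<length us. prod ?W (?A i))"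
        unfolding W using fit by (intro prod.cong) auto
      also have "\<dots> = prod ?W (leaves (Fun f ts))"
        using True by (simp, subst prod.UNION_disjoint) (auto simp: finite_leaves)
      finally show ?thesis using fit True u by auto
    next
      case False
      then obtain i where i: "i < length us" "\<not> fits (ts ! i) (us ! i)" by blast
      then have "weight G u (relabel g (Fun f ts)) = 0"
        unfolding W by (subst prod.remove[of _ i]) auto
      then show ?thesis using False True u by auto
    qed
  qed (use u in \<open>auto simp: weight_Fun[OF G]\<close>)
qed simp

section \<open>Equivalence closures and contexts\<close>

lemma equiv_closure_equiv: "equiv A r \<Longrightarrow> equiv_closure A r = r"
  unfolding equiv_closure_def by blast

lemma equiv_closure_empty: "equiv_closure A {} = Id_on A"
proof
  have "equiv A (Id_on A)"
    by (intro equivI refl_onI symI transI) auto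
  then show "equiv_closure A {} \<subseteq> Id_on A"
    unfolding equiv_closure_def by blast
  show "Id_on A \<subseteq> equiv_closure A {}"
    unfolding equiv_closure_def Id_on_def by (auto dest: equiv_class_self simp: equiv_def refl_on_def)
qed

lemma leaves_fill_context:
  assumes "c \<in> contexts \<Sigma> k" "length qs = k"
  shows "leaves (fill c (map Var qs)) = (\<lambda>(w, i). (w, qs ! (i - 1))) ` leaves c"
  unfolding fill_def
proof (rule leaves_subst_Var)
  fix i assume "i \<in> vars c"
  moreover have "c \<in> trees \<Sigma> {1..k}" using assms(1) by (simp add: contexts_def)
  ultimately have "i \<in> {1..k}" using vars_trees by blast
  then show "map Var qs ! (i - 1) = Var (qs ! (i - 1))" using assms(2) by auto
qed

text \<open>As the yield of a context lists each variable once, \<open>leaves c\<close> is the graph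
  of a function \<open>pc\<close> from variables to positions.\<close>

lemma context_leaf:
  assumes "c \<in> contexts \<Sigma> k"
  shows "\<exists>pc. \<forall>w i. (w, i) \<in> leaves c \<longleftrightarrow> i \<in> {1..k} \<and> w = pc i"
proof -
  have c: "vars c = {1..k}" "distinct (yield c)"
    using assms by (auto simp: contexts_def simp flip: set_yield simp del: upt_Suc)
  then have "\<forall>i\<in>{1..k}. \<exists>w. (w, i) \<in> leaves c" by (simp flip: vars_iff_leaves)
  then obtain pc where "\<forall>i\<in>{1..k}. (pc i, i) \<in> leaves c" by metis
  moreover have "i \<in> {1..k}" if "(w, i) \<in> leaves c" for w i
    using that c(1) vars_iff_leaves by metis
  ultimately show ?thesis using leaves_inject[OF c(2)] by (intro exI[of _ pc]) blast
qed

text \<open>An arbitrary but fixed occurrence of \<open>x\<close>: the one that will carry the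
  proper nonterminal while all others carry the sink.\<close>

definition leaf_of :: "('f, 'v) tree \<Rightarrow> 'v \<Rightarrow> pos" where
  "leaf_of t x = (SOME w. (w, x) \<in> leaves t)"

lemma leaf_of: "x \<in> vars t \<Longrightarrow> (leaf_of t x, x) \<in> leaves t"
  unfolding leaf_of_def vars_iff_leaves by (rule someI_ex)

section \<open>Preimages under a tree homomorphism\<close>

definition preimage :: "'f ranked \<Rightarrow> ('f \<Rightarrow> ('d, nat) tree) \<Rightarrow> ('d, 'w) tree \<Rightarrow> ('f, 'v) tree set" where
  "preimage \<Sigma> h u = {t \<in> trees \<Sigma> {}. apply_hom h t = u}"

lemma fill_inject:
  assumes "vars t = {1..k}" "length us = k" "length us' = k" "fill t us = fill t us'"
  shows "us = us'"
proof (rule nth_equalityI)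
  fix i assume "i < length us"
  then have "Suc i \<in> vars t" using assms(1,2) by simp
  from subst_tree_inject[OF assms(4)[unfolded fill_def] this]
  show "us ! i = us' ! i" by simp
qed (use assms in simp)

text \<open>Since \<open>h\<close> is nondeleting, \<open>u\<close> determines \<open>us\<close>.
  The children of a preimage with root \<open>f\<close> can therefore be chosen independently, each
  from the preimage of its entry of \<open>us\<close>.\<close>

lemma preimage_fill:
  assumes "nondeleting \<Sigma> h" "f \<in> symbols \<Sigma>" "length us = rank \<Sigma> f" "u = fill (h f) us"
  shows "{ts. Fun f ts \<in> preimage \<Sigma> h u} = lists_in (rank \<Sigma> f) (\<lambda>i. preimage \<Sigma> h (us ! i))"
proof -
  have "Fun f ts \<in> preimage \<Sigma> h u \<longleftrightarrow> length ts = rank \<Sigma> f \<and>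
      (\<forall>t\<in>set ts. t \<in> trees \<Sigma> {}) \<and> map (apply_hom h) ts = us" for ts
    using assms fill_inject[of "h f" "rank \<Sigma> f" "map (apply_hom h) ts" us]
    by (auto simp: preimage_def Fun_in_trees_iff nondeleting_def)
  then have "{ts. Fun f ts \<in> preimage \<Sigma> h u} = {ts. length ts = rank \<Sigma> f \<and>
      (\<forall>t\<in>set ts. t \<in> trees \<Sigma> {}) \<and> map (apply_hom h) ts = us}" by blast
  also have "\<dots> = lists_in (rank \<Sigma> f) (\<lambda>i. preimage \<Sigma> h (us ! i))"
    using assms(3) by (auto simp: lists_in_def preimage_def all_set_conv_all_nth list_eq_iff_nth_eq)
  finally show ?thesis .
qed

lemma preimage_not_fill:
  assumes "\<nexists>us. length us = rank \<Sigma> f \<and> u = fill (h f) us"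
  shows "Fun f ts \<notin> preimage \<Sigma> h u"
proof
  assume "Fun f ts \<in> preimage \<Sigma> h u"
  then have "length (map (apply_hom h) ts) = rank \<Sigma> f \<and> u = fill (h f) (map (apply_hom h) ts)"
    by (auto simp: preimage_def Fun_in_trees_iff)
  with assms show False by blast
qed

lemma size_fill:
  assumes "nondeleting \<Sigma> h" "nonerasing \<Sigma> h" "f \<in> symbols \<Sigma>" "i < rank \<Sigma> f"
  shows "size (us ! i) < size (fill (h f) us)"
  using size_subst_less[of "Suc i" "h f" "\<lambda>i. us ! (i - 1)"] assms
  by (auto simp: fill_def nondeleting_def nonerasing_def)

lemma fill_in_trees:
  assumes "nondeleting \<Sigma> h" "f \<in> symbols \<Sigma>" "i < rank \<Sigma> f" "fill (h f) us \<in> trees \<Delta> Z"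
  shows "us ! i \<in> trees \<Delta> Z"
  using subst_in_trees[of "\<lambda>i. us ! (i - 1)" "h f" \<Delta> Z "Suc i"] assms
  by (auto simp: fill_def nondeleting_def)

text \<open>There are finitely many root symbols, and for each of them the children come from
  preimages of strictly smaller trees.\<close>

lemma finite_preimage:
  fixes \<Sigma> :: "'f ranked"
  assumes "ranked_alphabet \<Sigma>" "nondeleting \<Sigma> h" "nonerasing \<Sigma> h"
  shows "finite (preimage \<Sigma> h u :: ('f, 'v) tree set)"
proof (induction "size u" arbitrary: u rule: less_induct)
  case less
  have "finite {ts :: ('f, 'v) tree list. Fun f ts \<in> preimage \<Sigma> h u}" if f: "f \<in> symbols \<Sigma>" for f
  proof (cases "\<exists>us. length us = rank \<Sigma> f \<and> u = fill (h f) us")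
    case True
    then obtain us where us: "length us = rank \<Sigma> f" "u = fill (h f) us" by blast
    have "finite (preimage \<Sigma> h (us ! i) :: ('f, 'v) tree set)" if "i < rank \<Sigma> f" for i
      using less[of "us ! i"] size_fill[OF assms(2,3) f that, of us] us(2) by simp
    then show ?thesis
      unfolding preimage_fill[OF assms(2) f us] by (rule finite_lists_in)
  qed (simp add: preimage_not_fill)
  then have "finite (\<Union>f\<in>symbols \<Sigma>. Fun f ` {ts :: ('f, 'v) tree list. Fun f ts \<in> preimage \<Sigma> h u})"
    using assms(1) by (auto simp: ranked_alphabet_def)
  moreover have "preimage \<Sigma> h u \<subseteq> (\<Union>f\<in>symbols \<Sigma>. Fun f ` {ts :: ('f, 'v) tree list. Fun f ts \<in> preimage \<Sigma> h u})"
  proof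
    fix t :: "('f, 'v) tree" assume t: "t \<in> preimage \<Sigma> h u"
    then have "t \<in> trees \<Sigma> {}" by (simp add: preimage_def)
    then show "t \<in> (\<Union>f\<in>symbols \<Sigma>. Fun f ` {ts. Fun f ts \<in> preimage \<Sigma> h u})"
      using t by cases auto
  qed
  ultimately show ?case by (rule finite_subset[rotated])
qed

section \<open>The grammar for the homomorphic image\<close>

text \<open>The new nonterminals are natural numbers: \<open>e\<close> codes those of
  \<open>G\<close> by nonzero numbers and so keeps \<open>0\<close> free for the sink.\<close>

locale hom_wta =
  fixes \<Delta> :: "'d ranked"
    and G :: "('q, 'f, 's :: {comm_semiring_0, comm_monoid_mult}) wtgc"
    and h :: "'f \<Rightarrow> ('d, nat) tree"
    and e :: "'q \<Rightarrow> nat"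
  assumes alphabet: "ranked_alphabet \<Delta>" and wta: "is_wta G"
    and hom: "tree_hom (alphabet G) \<Delta> h"
    and nondel: "nondeleting (alphabet G) h" and noner: "nonerasing (alphabet G) h"
    and e_inj: "inj_on e (nonterminals G)" and e_pos: "\<And>q. e q \<noteq> 0"
begin

abbreviation "\<Sigma> \<equiv> alphabet G"
abbreviation "Q \<equiv> nonterminals G"
abbreviation preim :: "('d, nat) tree \<Rightarrow> ('f, 'q) tree set" where
  "preim \<equiv> preimage \<Sigma> h"

declare e_pos [simp]

lemma G: "is_wtgc G"
  using wta by (simp add: is_wta_def)

text \<open>The nonterminal \<open>0\<close> is the sink.\<close>

definition leaf_label :: "'f \<Rightarrow> 'q list \<Rightarrow> pos \<Rightarrow> nat \<Rightarrow> nat" where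
  "leaf_label f qs w x = (if w = leaf_of (h f) x then e (qs ! (x - 1)) else 0)"

text \<open>Taking all pairs of occurrences of a common variable, including reflexive and symmetric
  ones, makes the induced constraint relation an equivalence without any closure.\<close>

definition image_of :: "'f \<Rightarrow> 'q list \<Rightarrow> 'q \<Rightarrow> ('d, nat) production" where
  "image_of f qs q = Production (relabel (leaf_label f qs) (h f)) (e q)
     {(v, v'). \<exists>x. (v, x) \<in> leaves (h f) \<and> (v', x) \<in> leaves (h f)} {}"

text \<open>For a normalized production, \<open>yield\<close> recovers the list of nonterminals of
  the left-hand side; a \<open>Var\<close> case cannot arise.\<close>

definition image_production :: "('f, 'q) production \<Rightarrow> ('d, nat) production" where
  "image_production p = (case lhs p of Fun f ss \<Rightarrow> image_of f (yield (lhs p)) (target p))"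

definition sink_productions :: "('d, nat) production set" where
  "sink_productions =
    (\<lambda>f. Production (Fun f (replicate (rank \<Delta> f) (Var 0))) 0 {} {}) ` symbols \<Delta>"

text \<open>Different symbols with the same \<open>h\<close>-tree can give the same image
  production, hence the sum in \<open>wt\<close>. As \<open>e\<close> avoids \<open>0\<close>, the
  target alone tells sink productions from images.\<close>

definition image_grammar :: "(nat, 'd, 's) wtgc" where
  "image_grammar = \<lparr>
     nonterminals = insert 0 (e ` Q),
     alphabet = \<Delta>,
     final = (\<lambda>n. if n = 0 then 0 else final G (inv_into Q e n)),
     productions = image_production ` productions G \<union> sink_productions,
     wt = (\<lambda>p'. if target p' = 0 then 1 else \<Sum>p | p \<in> productions G \<and> image_production p = p'. wt G p)\<rparr>"

abbreviation "G' \<equiv> image_grammar"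

lemma production_cases:
  assumes "p \<in> productions G"
  obtains f qs where "lhs p = Fun f (map Var qs)" "f \<in> symbols \<Sigma>" "length qs = rank \<Sigma> f"
    "set qs \<subseteq> Q" "target p \<in> Q" "fulfils t p" "image_production p = image_of f qs (target p)"
proof -
  have p: "normalized G p" "eqs p = {}" "ineqs p = {}" "target p \<in> Q"
    using assms wta by (auto simp: is_wta_def is_wtgc_def)
  obtain f qs where f: "lhs p = Fun f (map Var qs)" "f \<in> symbols \<Sigma>" "length qs = rank \<Sigma> f"
    "set qs \<subseteq> Q" using p(1) by (auto simp: normalized_def)
  have "yield (lhs p) = qs" using f(1) by (simp add: comp_def)
  then have "image_production p = image_of f qs (target p)" by (simp add: image_production_def f(1))
  with that f p show ?thesis by (simp add: fulfils_def)
qed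

lemma h_in_trees: "f \<in> symbols \<Sigma> \<Longrightarrow> h f \<in> trees \<Delta> {1..rank \<Sigma> f}"
  using hom by (simp add: tree_hom_def)

lemma vars_h: "f \<in> symbols \<Sigma> \<Longrightarrow> vars (h f) = {1..rank \<Sigma> f}"
  using nondel by (simp add: nondeleting_def)

lemma leaf_label_mem:
  assumes "f \<in> symbols \<Sigma>" "length qs = rank \<Sigma> f" "set qs \<subseteq> Q" "(w, x) \<in> leaves (h f)"
  shows "leaf_label f qs w x \<in> insert 0 (e ` Q)"
proof -
  have "x \<in> {1..rank \<Sigma> f}" using assms(1,4) vars_h vars_iff_leaves by metis
  then have "qs ! (x - 1) \<in> Q" using assms(2,3) by (auto intro!: subsetD[OF assms(3)] nth_mem)
  then show ?thesis by (simp add: leaf_label_def)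
qed

section \<open>Syntactic properties of the image grammar\<close>

lemma is_wtgc_image_grammar: "is_wtgc G'"
proof -
  have "finite Q" "finite (productions G)" using G by (auto simp: is_wtgc_def)
  moreover have "finite sink_productions"
    using alphabet by (simp add: sink_productions_def ranked_alphabet_def)
  moreover have "lhs p \<in> trees \<Delta> (insert 0 (e ` Q)) - Var ` insert 0 (e ` Q) \<and>
      target p \<in> insert 0 (e ` Q) \<and> finite (eqs p) \<and> finite (ineqs p)"
    if "p \<in> sink_productions" for p
    using that by (auto simp: sink_productions_def Fun_in_trees_iff intro: trees.Var)
  moreover have "lhs (image_production p) \<in> trees \<Delta> (insert 0 (e ` Q)) - Var ` insert 0 (e ` Q) \<and>
      target (image_production p) \<in> insert 0 (e ` Q) \<and> finite (eqs (image_production p)) \<and> finite (ineqs (image_production p))"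
    if p: "p \<in> productions G" for p
  proof -
    obtain f qs where f: "f \<in> symbols \<Sigma>" "length qs = rank \<Sigma> f"
      "set qs \<subseteq> Q" "target p \<in> Q" "image_production p = image_of f qs (target p)"
      using production_cases[OF p] by metis
    have "relabel (leaf_label f qs) (h f) \<in> trees \<Delta> (insert 0 (e ` Q))"
      using h_in_trees[OF f(1)] leaf_label_mem[OF f(1,2,3)] by (rule relabel_in_trees)
    \<comment> \<open>Nonerasing keeps the left-hand side from being a bare nonterminal.\<close>
    moreover have "h f \<notin> range Var" using noner f(1) by (simp add: nonerasing_def)
    then have "relabel (leaf_label f qs) (h f) \<notin> range Var" by (cases "h f") auto
    moreover have "finite {(v, v'). \<exists>x. (v, x) \<in> leaves (h f) \<and> (v', x) \<in> leaves (h f)}"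
      by (rule finite_subset[of _ "fst ` leaves (h f) \<times> fst ` leaves (h f)"])
        (force simp: finite_leaves)+
    ultimately show ?thesis using f by (auto simp: image_of_def)
  qed
  ultimately show ?thesis
    using alphabet by (auto simp: is_wtgc_def image_grammar_def)
qed

lemma target_image_production: "p \<in> productions G \<Longrightarrow> target (image_production p) = e (target p)"
  by (erule production_cases) (simp add: image_of_def)

lemma positive_image_grammar: "positive G'"
  by (auto simp: positive_def image_grammar_def sink_productions_def image_of_def
      elim: production_cases)

lemma classic_image_grammar: "classic G'"
proof -
  have "v \<in> positions_of (Inr ` insert 0 (e ` Q)) (lhs (image_production p)) \<and>
      v' \<in> positions_of (Inr ` insert 0 (e ` Q)) (lhs (image_production p))"
    if p: "p \<in> productions G" and "(v, v') \<in> eqs (image_production p) \<union> ineqs (image_production p)" for p v v'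
  proof -
    obtain f qs where f: "f \<in> symbols \<Sigma>" "length qs = rank \<Sigma> f"
      "set qs \<subseteq> Q" "target p \<in> Q" "image_production p = image_of f qs (target p)"
      using production_cases[OF p] by metis
    have "w \<in> positions_of (Inr ` insert 0 (e ` Q)) (lhs (image_production p))"
      if w: "(w, x) \<in> leaves (h f)" for w x
    proof -
      \<comment> \<open>Relabelling preserves leaf positions, so every constrained position carries
        a nonterminal.\<close>
      have "(w, leaf_label f qs w x) \<in> leaves (lhs (image_production p))"
        using w by (force simp: f(5) image_of_def leaves_relabel)
      then show ?thesis using leaf_label_mem[OF f(1-3) w]
        by (auto simp: leaves_iff positions_of_def)
    qed
    then show ?thesis using that f by (auto simp: image_of_def)
  qed
  then show ?thesis
    by (fastforce simp: classic_def image_grammar_def sink_productions_def)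
qed

lemma sink_image_grammar: "sink G' 0"
proof -
  have "{p \<in> productions G'. target p = 0} = sink_productions"
    by (auto simp: image_grammar_def sink_productions_def target_image_production)
  then show ?thesis
    by (auto simp: sink_def image_grammar_def sink_productions_def)
qed

text \<open>For an image production, each class of constrained positions consists of the occurrences
  of one variable of \<open>h f\<close>, and \<open>leaf_label\<close> gives exactly one of them a
  nonzero label.\<close>

lemma eq_restricted_image_grammar: "eq_restricted G'"
proof -
  have restricted: "\<exists>q'\<in>nonterminals G'.
      let C = equiv_closure {1..k} (context_constraints k c (eqs p)) `` {i} in
        {ps ! (j - 1) |j. j \<in> C} \<subseteq> {q', 0} \<and> (\<exists>!j. j \<in> C \<and> ps ! (j - 1) = q')"
    if p: "p \<in> productions G'" and c: "c \<in> contexts \<Delta> k" and ps: "length ps = k"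
      and lhs: "lhs p = fill c (map Var ps)" and i: "i \<in> {1..k}" for p k c ps i
  proof -
    obtain pc where pc: "\<And>w i. (w, i) \<in> leaves c \<longleftrightarrow> i \<in> {1..k} \<and> w = pc i"
      using context_leaf[OF c] by blast
    then have pcI: "(pc j, j) \<in> leaves c" if "j \<in> {1..k}" for j using that by blast
    have leaves_lhs: "leaves (lhs p) = (\<lambda>(w, i). (w, ps ! (i - 1))) ` leaves c"
      unfolding lhs using leaves_fill_context[OF c ps] .
    from p consider "p \<in> sink_productions" | p0 where "p0 \<in> productions G" "p = image_production p0"
      by (auto simp: image_grammar_def)
    then show ?thesis
    proof cases
      case 1
      \<comment> \<open>Without constraints the classes are singletons, and the sink itself serves
        as \<open>q'\<close>.\<close>
      then have "eqs p = {}" "\<forall>(w, x)\<in>leaves (lhs p). x = 0"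
        by (auto simp: sink_productions_def)
      moreover have "(pc i, ps ! (i - 1)) \<in> leaves (lhs p)"
        unfolding leaves_lhs using pcI[OF i] by force
      moreover have "equiv_closure {1..k} (context_constraints k c {}) `` {i} = {i}"
        using i by (auto simp: context_constraints_def equiv_closure_empty)
      ultimately show ?thesis by (auto simp: Let_def image_grammar_def)
    next
      case 2
      obtain f qs where f: "f \<in> symbols \<Sigma>" "length qs = rank \<Sigma> f"
        "set qs \<subseteq> Q" "image_production p0 = image_of f qs (target p0)"
        using production_cases[OF 2(1)] by metis
      have lhs': "leaves (lhs p) = (\<lambda>(w, x). (w, leaf_label f qs w x)) ` leaves (h f)"
        using 2 f by (simp add: image_of_def leaves_relabel)
      \<comment> \<open>The context \<open>c\<close> is known only through the left-hand side, so it
        is compared with \<open>h f\<close> by leaf positions.\<close>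
      have "fst ` leaves (lhs p) = fst ` leaves c"
        by (simp add: leaves_lhs image_image case_prod_unfold)
      moreover have "fst ` leaves (lhs p) = fst ` leaves (h f)"
        by (simp add: lhs' image_image case_prod_unfold)
      ultimately have fst_eq: "fst ` leaves (h f) = fst ` leaves c" by simp
      have "\<exists>x. (pc j, x) \<in> leaves (h f)" if "j \<in> {1..k}" for j
      proof -
        have "pc j \<in> fst ` leaves c" using pcI[OF that] by force
        then show ?thesis unfolding fst_eq[symmetric] by force
      qed
      \<comment> \<open>\<open>x j\<close> is the variable of \<open>h f\<close> at the place of the
        \<open>j\<close>-th leaf; different \<open>j\<close> share a value when \<open>h f\<close>
        copies a variable.\<close>
      then obtain x where "\<forall>j\<in>{1..k}. (pc j, x j) \<in> leaves (h f)"
        using bchoice[of "{1..k}" "\<lambda>j x. (pc j, x) \<in> leaves (h f)"] by blast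
      then have x: "(pc j, x j) \<in> leaves (h f)" if "j \<in> {1..k}" for j
        using that by blast
      have label: "ps ! (j - 1) = leaf_label f qs (pc j) (x j)" if j: "j \<in> {1..k}" for j
      proof -
        have "(pc j, ps ! (j - 1)) \<in> leaves (lhs p)" unfolding leaves_lhs using pcI[OF j] by force
        moreover have "(pc j, leaf_label f qs (pc j) (x j)) \<in> leaves (lhs p)"
          unfolding lhs' using x[OF j] by force
        ultimately show ?thesis by (rule leaves_unique)
      qed
      \<comment> \<open>Seen on leaf indices, the constraints are the kernel of \<open>x\<close>,
        hence already an equivalence relation.\<close>
      have CC: "context_constraints k c (eqs p) = {(i, j) \<in> {1..k} \<times> {1..k}. x i = x j}"
      proof -
        have label_c: "v \<in> positions c \<and> label c v = Inr j \<longleftrightarrow> v = pc j"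
          if "j \<in> {1..k}" for v j
          using pc[of v j] that by (simp add: leaves_iff)
        define P where "P i j \<longleftrightarrow> (\<exists>(v, v')\<in>eqs p. v \<in> positions c \<and> v' \<in> positions c \<and>
            label c v = Inr i \<and> label c v' = Inr j)" for i j
        have P: "P i j \<longleftrightarrow> x i = x j" if "i \<in> {1..k}" "j \<in> {1..k}" for i j
        proof -
          have "v \<in> positions c \<and> v' \<in> positions c \<and> label c v = Inr i \<and> label c v' = Inr j \<longleftrightarrow>
              v = pc i \<and> v' = pc j" for v v'
            using label_c[OF that(1), of v] label_c[OF that(2), of v'] by blast
          then have "P i j \<longleftrightarrow> (pc i, pc j) \<in> eqs p" unfolding P_def by auto
          also have "\<dots> \<longleftrightarrow> (\<exists>y. (pc i, y) \<in> leaves (h f) \<and> (pc j, y) \<in> leaves (h f))"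
            by (simp add: 2(2) f(4) image_of_def)
          also have "\<dots> \<longleftrightarrow> x i = x j"
            using x[OF that(1)] x[OF that(2)] leaves_unique by metis
          finally show ?thesis .
        qed
        show ?thesis
          unfolding context_constraints_def P_def[symmetric] using P by blast
      qed
      have "equiv {1..k} (context_constraints k c (eqs p))"
        unfolding CC by (auto simp: equiv_def refl_on_def sym_def trans_def)
      then have C: "equiv_closure {1..k} (context_constraints k c (eqs p)) `` {i} =
          {j \<in> {1..k}. x j = x i}"
        using i by (auto simp: equiv_closure_equiv CC)
      have xi: "x i \<in> vars (h f)" using x[OF i] vars_iff_leaves by metis
      let ?q = "qs ! (x i - 1)"
      have "x i \<in> {1..rank \<Sigma> f}" using xi f(1) by (simp add: vars_h)
      then have q_mem: "?q \<in> Q" using f(2) by (auto intro!: subsetD[OF f(3)] nth_mem)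
      have subset: "{ps ! (j - 1) |j. j \<in> {j \<in> {1..k}. x j = x i}} \<subseteq> {e ?q, 0}"
        by (auto simp: label leaf_label_def simp del: One_nat_def)
      have unique: "\<exists>!j. j \<in> {j \<in> {1..k}. x j = x i} \<and> ps ! (j - 1) = e ?q"
      proof -
        \<comment> \<open>The chosen occurrence is a leaf position of the context too, which yields
          the index \<open>j\<close> carrying \<open>e ?q\<close>.\<close>
        have "leaf_of (h f) (x i) \<in> fst ` leaves c"
          unfolding fst_eq[symmetric] using leaf_of[OF xi] by force
        then obtain j where j: "j \<in> {1..k}" "pc j = leaf_of (h f) (x i)" using pc by auto
        have xj: "x j = x i" using x[OF j(1)] leaf_of[OF xi] j(2) leaves_unique by metis
        show ?thesis
        proof (rule ex1I[of _ j])
          show "j \<in> {j \<in> {1..k}. x j = x i} \<and> ps ! (j - 1) = e ?q"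
            using j xj label[OF j(1)] by (simp add: leaf_label_def)
        next
          fix j' assume "j' \<in> {j \<in> {1..k}. x j = x i} \<and> ps ! (j' - 1) = e ?q"
          then have j': "j' \<in> {1..k}" "x j' = x i" "ps ! (j' - 1) = e ?q" by auto
          \<comment> \<open>A nonzero label can only stand at the chosen occurrence, which
            determines the position and with it the index.\<close>
          then have "leaf_label f qs (pc j') (x j') \<noteq> 0"
            using label[OF j'(1)] e_pos[of ?q] by argo
          then have "pc j' = pc j" using j(2) j'(2) by (simp add: leaf_label_def split: if_splits)
          then show "j' = j" using leaves_unique pcI[OF j'(1)] pcI[OF j(1)] by metis
        qed
      qed
      show ?thesis
        unfolding Let_def C
      proof (rule bexI[of _ "e ?q"], rule conjI)
        show "e ?q \<in> nonterminals G'" using q_mem by (simp add: image_grammar_def)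
      qed (fact subset, fact unique)
    qed
  qed
  have alphabet_G': "alphabet G' = \<Delta>" by (simp add: image_grammar_def)
  show ?thesis
    unfolding eq_restricted_def alphabet_G'
    by (intro conjI exI[of _ 0] ballI allI impI is_wtgc_image_grammar classic_image_grammar
        sink_image_grammar restricted) auto
qed

section \<open>Weights in the image grammar\<close>

lemma weight_sink: "u \<in> trees \<Delta> {} \<Longrightarrow> weight G' u (Var 0) = 1"
proof (induction rule: trees.induct)
  case (Fun f ts)
  let ?u = "Fun f ts" and ?p = "\<lambda>g. Production (Fun g (replicate (rank \<Delta> g) (Var 0))) 0 {} {}"
  have "?u \<in> trees \<Delta> {}" using Fun by (auto simp: Fun_in_trees_iff)
  then have "vars ?u = {}" using vars_trees by blast
  have "{p \<in> productions G'. target p = 0 \<and> fulfils ?u p} = ?p ` symbols \<Delta>"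
    by (auto simp: image_grammar_def sink_productions_def target_image_production fulfils_def)
  then have "weight G' ?u (Var 0) = (\<Sum>p\<in>?p ` symbols \<Delta>. wt G' p * weight G' ?u (lhs p))"
    using weight_Var[OF is_wtgc_image_grammar \<open>vars ?u = {}\<close>] by simp
  also have "\<dots> = (\<Sum>g\<in>symbols \<Delta>. weight G' ?u (Fun g (replicate (rank \<Delta> g) (Var 0))))"
    by (subst sum.reindex) (auto simp: inj_on_def image_grammar_def)
  \<comment> \<open>Only the sink production with the root symbol of the tree matches, and its
    children contribute factors 1 by induction.\<close>
  also have "\<dots> = (\<Sum>g\<in>symbols \<Delta>. if f = g then 1 else 0)"
    using Fun by (intro sum.cong) (auto simp: weight_Fun[OF is_wtgc_image_grammar])
  also have "\<dots> = 1" using alphabet Fun.hyps by (simp add: ranked_alphabet_def)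
  finally show ?case .
qed simp

text \<open>All occurrences of a variable in \<open>h f\<close> stand over the same entry of
  \<open>us\<close>, so the constraints hold. Occurrences labelled with the sink contribute 1, which
  leaves one factor per variable even though \<open>h f\<close> may copy variables.\<close>

lemma weight_lhs_image_of:
  assumes f: "f \<in> symbols \<Sigma>" and u: "u \<in> trees \<Delta> {}"
    and us: "length us = rank \<Sigma> f" "u = fill (h f) us"
  shows "fulfils u (image_of f qs q)"
    and "weight G' u (lhs (image_of f qs q)) =
      (\<Prod>i<rank \<Sigma> f. weight G' (us ! i) (Var (e (qs ! i))))"
proof -
  define \<theta> where "\<theta> = (\<lambda>i. us ! (i - 1))"
  have u_subst: "u = subst_tree \<theta> (h f)" using us(2) by (simp add: fill_def \<theta>_def)
  note sub = subtree_subst[of _ _ "h f" \<theta>, folded u_subst]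
  show "fulfils u (image_of f qs q)"
  proof -
    have "satisfies u (v, v')" if "(v, x) \<in> leaves (h f)" "(v', x) \<in> leaves (h f)" for v v' x
      using sub[OF that(1)] sub[OF that(2)] by (simp add: satisfies_def)
    then show ?thesis by (auto simp: fulfils_def image_of_def)
  qed
  let ?W = "\<lambda>(w, x). weight G' (subtree u w) (Var (leaf_label f qs w x))"
  let ?S = "(\<lambda>i. (leaf_of (h f) (Suc i), Suc i)) ` {..<rank \<Sigma> f}"
  have vars: "vars u = {}" using u vars_trees by blast
  have "fits (h f) u" unfolding u_subst by (rule fits_subst)
  then have "weight G' u (lhs (image_of f qs q)) = prod ?W (leaves (h f))"
    using weight_relabel[OF is_wtgc_image_grammar vars, of "leaf_label f qs" "h f"]
    by (simp add: image_of_def)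
  also have "\<dots> = prod ?W ?S"
  proof (rule prod.mono_neutral_right)
    show "?S \<subseteq> leaves (h f)" using f by (auto simp: vars_h intro!: leaf_of)
    show "\<forall>y\<in>leaves (h f) - ?S. ?W y = 1"
    proof clarify
      fix w x assume wx: "(w, x) \<in> leaves (h f)" "(w, x) \<notin> ?S"
      then have x: "x \<in> vars (h f)" using vars_iff_leaves by metis
      then have "x \<in> {1..rank \<Sigma> f}" using f by (simp add: vars_h)
      then have "(leaf_of (h f) x, x) \<in> ?S" by (intro image_eqI[of _ _ "x - 1"]) auto
      then have "w \<noteq> leaf_of (h f) x" using wx(2) by blast
      moreover have "\<theta> x \<in> trees \<Delta> {}" using u x unfolding u_subst by (rule subst_in_trees)
      ultimately show "weight G' (subtree u w) (Var (leaf_label f qs w x)) = 1"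
        using sub(2)[OF wx(1)] by (simp add: leaf_label_def weight_sink)
    qed
  qed (rule finite_leaves)
  also have "\<dots> = (\<Prod>i<rank \<Sigma> f. ?W (leaf_of (h f) (Suc i), Suc i))"
    by (subst prod.reindex) (auto simp: inj_on_def)
  also have "\<dots> = (\<Prod>i<rank \<Sigma> f. weight G' (us ! i) (Var (e (qs ! i))))"
  proof (rule prod.cong)
    fix i assume "i \<in> {..<rank \<Sigma> f}"
    then have "(leaf_of (h f) (Suc i), Suc i) \<in> leaves (h f)"
      using f by (intro leaf_of) (auto simp: vars_h)
    from sub(2)[OF this]
    show "?W (leaf_of (h f) (Suc i), Suc i) = weight G' (us ! i) (Var (e (qs ! i)))"
      by (simp add: leaf_label_def \<theta>_def)
  qed simp
  finally show "weight G' u (lhs (image_of f qs q)) =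
      (\<Prod>i<rank \<Sigma> f. weight G' (us ! i) (Var (e (qs ! i))))" .
qed

text \<open>If \<open>h f\<close> fitted \<open>u\<close>, the fulfilled constraints would make the
  subtrees at all occurrences of each variable equal, and \<open>u\<close> would be an instance of
  \<open>h f\<close> after all.\<close>

lemma weight_lhs_image_of_0:
  assumes f: "f \<in> symbols \<Sigma>" and u: "vars u = {}"
    and no: "\<nexists>us. length us = rank \<Sigma> f \<and> u = fill (h f) us"
    and ful: "fulfils u (image_of f qs q)"
  shows "weight G' u (lhs (image_of f qs q)) = 0"
proof -
  have "\<not> fits (h f) u"
  proof
    assume fit: "fits (h f) u"
    \<comment> \<open>The arguments are read off at the chosen occurrences.\<close>
    let ?us = "map (\<lambda>i. subtree u (leaf_of (h f) (Suc i))) [0..<rank \<Sigma> f]"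
    have "u = subst_tree (\<lambda>i. ?us ! (i - 1)) (h f)"
    proof (rule fits_imp_subst[OF fit])
      fix w x assume w: "(w, x) \<in> leaves (h f)"
      then have x: "x \<in> vars (h f)" using vars_iff_leaves by metis
      then have "x \<in> {1..rank \<Sigma> f}" using f by (simp add: vars_h)
      then have "?us ! (x - 1) = subtree u (leaf_of (h f) x)" by auto
      moreover have "(w, leaf_of (h f) x) \<in> eqs (image_of f qs q)"
        using w leaf_of[OF x] by (auto simp: image_of_def)
      then have "subtree u w = subtree u (leaf_of (h f) x)"
        using ful by (auto simp: fulfils_def satisfies_def)
      ultimately show "subtree u w = ?us ! (x - 1)" by simp
    qed
    then show False using no by (metis fill_def length_map length_upt diff_zero)
  qed
  then show ?thesis
    using weight_relabel[OF is_wtgc_image_grammar u, of "leaf_label f qs" "h f"] by (simp add: image_of_def)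
qed

text \<open>The nonterminal must vary in the induction, as the arguments of \<open>h f\<close> are
  treated at the nonterminals \<open>qs ! i\<close>.\<close>

lemma weight_image_grammar:
  assumes "u \<in> trees \<Delta> {}" "q \<in> Q"
  shows "weight G' u (Var (e q)) = (\<Sum>t\<in>preim u. weight G t (Var q))"
  using assms
proof (induction "size u" arbitrary: u q rule: less_induct)
  case less
  note u = less.prems(1)
  have vars: "vars u = {}" using u vars_trees by blast
  have fin_pre: "finite (preim u)"
    using G nondel noner by (intro finite_preimage) (auto simp: is_wtgc_def)
  have fin: "finite (productions G)" using G by (simp add: is_wtgc_def)
  \<comment> \<open>Compares both grammars one production at a time. An unfulfilled image counts as
    0, so that the sum can later run over all productions with target \<open>q\<close>.\<close>
  have step: "(if fulfils u (image_production p) then weight G' u (lhs (image_production p)) else 0) =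
      (\<Sum>t\<in>preim u. weight G t (lhs p))" if p: "p \<in> productions G" for p
  proof -
    obtain f qs where f: "lhs p = Fun f (map Var qs)" "f \<in> symbols \<Sigma>" "length qs = rank \<Sigma> f"
      "set qs \<subseteq> Q" "image_production p = image_of f qs (target p)"
      using production_cases[OF p] by metis
    let ?T = "{ts. Fun f ts \<in> preim u}"
    have "(\<Sum>t\<in>preim u. weight G t (lhs p)) = (\<Sum>t\<in>Fun f ` ?T. weight G t (lhs p))"
    \<comment> \<open>A tree whose root differs from \<open>f\<close> has weight 0 at this left-hand
      side.\<close>
    proof (rule sum.mono_neutral_right[OF fin_pre])
      show "\<forall>t\<in>preim u - Fun f ` ?T. weight G t (lhs p) = 0"
      proof
        fix t assume t: "t \<in> preim u - Fun f ` ?T"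
        then have "t \<in> trees \<Sigma> {}" by (simp add: preimage_def)
        then show "weight G t (lhs p) = 0"
          using t by cases (auto simp: f(1) weight_Fun[OF G])
      qed
    qed auto
    also have "\<dots> = (\<Sum>ts\<in>?T. weight G (Fun f ts) (lhs p))"
      by (subst sum.reindex) (auto simp: inj_on_def)
    finally have rhs: "(\<Sum>t\<in>preim u. weight G t (lhs p)) =
        (\<Sum>ts\<in>?T. weight G (Fun f ts) (lhs p))" .
    show ?thesis
    proof (cases "\<exists>us. length us = rank \<Sigma> f \<and> u = fill (h f) us")
      case True
      then obtain us where us: "length us = rank \<Sigma> f" "u = fill (h f) us" by blast
      have "(if fulfils u (image_production p) then weight G' u (lhs (image_production p)) else 0) =
          (\<Prod>i<rank \<Sigma> f. weight G' (us ! i) (Var (e (qs ! i))))"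
        using weight_lhs_image_of[OF f(2) u us] f(5) by simp
      also have "\<dots> = (\<Prod>i<rank \<Sigma> f. \<Sum>t\<in>preim (us ! i). weight G t (Var (qs ! i)))"
      proof (rule prod.cong)
        fix i assume "i \<in> {..<rank \<Sigma> f}"
        then have i: "i < rank \<Sigma> f" by simp
        show "weight G' (us ! i) (Var (e (qs ! i))) =
            (\<Sum>t\<in>preim (us ! i). weight G t (Var (qs ! i)))"
        proof (rule less.hyps)
          show "size (us ! i) < size u" using size_fill[OF nondel noner f(2) i] us by simp
          show "us ! i \<in> trees \<Delta> {}" using fill_in_trees[OF nondel f(2) i] us u by simp
          show "qs ! i \<in> Q" using f(3,4) i by auto
        qed
      qed simp
      \<comment> \<open>Choosing a preimage for every argument is the same as choosing the children
        of a preimage of \<open>u\<close> with root \<open>f\<close>.\<close>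
      also have "\<dots> = (\<Sum>ts\<in>?T. \<Prod>i<rank \<Sigma> f. weight G (ts ! i) (Var (qs ! i)))"
        unfolding prod_sum_lists_in preimage_fill[OF nondel f(2) us] ..
      also have "\<dots> = (\<Sum>ts\<in>?T. weight G (Fun f ts) (lhs p))"
        using f(3) by (intro sum.cong)
          (auto simp: f(1) weight_Fun[OF G] preimage_def Fun_in_trees_iff)
      finally show ?thesis using rhs by simp
    next
      case False
      then have "?T = {}" by (simp add: preimage_not_fill[of \<Sigma> f u h, OF False])
      then show ?thesis
        unfolding rhs using weight_lhs_image_of_0[OF f(2) vars False] f(5) by simp
    qed
  qed
  let ?P = "{p \<in> productions G. target p = q}"
  let ?R = "{p \<in> productions G. target p = q \<and> fulfils u (image_production p)}"
  have img: "{p' \<in> productions G'. target p' = e q \<and> fulfils u p'} = image_production ` ?R"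
  proof -
    have "e (target p) = e q \<longleftrightarrow> target p = q" if "p \<in> productions G" for p
      using that less.prems(2) e_inj G by (auto simp: is_wtgc_def inj_on_def)
    then show ?thesis
      by (auto simp: image_grammar_def sink_productions_def target_image_production)
  qed
  have "weight G' u (Var (e q)) = (\<Sum>p'\<in>image_production ` ?R. wt G' p' * weight G' u (lhs p'))"
    using weight_Var[OF is_wtgc_image_grammar vars] img by simp
  also have "\<dots> = (\<Sum>p'\<in>image_production ` ?R. \<Sum>p | p \<in> ?R \<and> image_production p = p'. wt G p * weight G' u (lhs (image_production p)))"
  proof (rule sum.cong)
    fix p' assume p': "p' \<in> image_production ` ?R"
    then obtain p where p: "p \<in> ?R" "p' = image_production p" by blast
    \<comment> \<open>Target and fulfilment depend only on the image, the target because
      \<open>e\<close> is injective on \<open>Q\<close>; so \<open>?R\<close> contains the whole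
      fibre over \<open>p'\<close>.\<close>
    have "{p0 \<in> productions G. image_production p0 = p'} = {p0. p0 \<in> ?R \<and> image_production p0 = p'}"
    proof -
      have "p0 \<in> ?R" if "p0 \<in> productions G" "image_production p0 = p'" for p0
      proof -
        have "e (target p0) = e (target p)" using that p target_image_production by (metis (lifting) mem_Collect_eq)
        then have "target p0 = target p" using that p e_inj G by (auto simp: is_wtgc_def inj_on_def)
        then show ?thesis using that p by simp
      qed
      then show ?thesis by blast
    qed
    moreover have "target p' \<noteq> 0" using p by (auto simp: target_image_production)
    ultimately have "wt G' p' = (\<Sum>p | p \<in> ?R \<and> image_production p = p'. wt G p)"
      by (simp add: image_grammar_def)
    then show "wt G' p' * weight G' u (lhs p') =
        (\<Sum>p | p \<in> ?R \<and> image_production p = p'. wt G p * weight G' u (lhs (image_production p)))"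
      by (simp add: sum_distrib_right)
  qed simp
  \<comment> \<open>Summing over the fibres of \<open>image_production\<close> undoes the merging of
    weights.\<close>
  also have "\<dots> = (\<Sum>p\<in>?R. wt G p * weight G' u (lhs (image_production p)))"
    using fin by (intro sum.image_gen[symmetric]) auto
  also have "\<dots> = (\<Sum>p\<in>?P. wt G p *
      (if fulfils u (image_production p) then weight G' u (lhs (image_production p)) else 0))"
    using fin by (intro sum.mono_neutral_cong_left) auto
  also have "\<dots> = (\<Sum>p\<in>?P. \<Sum>t\<in>preim u. wt G p * weight G t (lhs p))"
    by (intro sum.cong) (auto simp: step sum_distrib_left)
  also have "\<dots> = (\<Sum>t\<in>preim u. \<Sum>p\<in>?P. wt G p * weight G t (lhs p))"
    by (rule sum.swap)
  also have "\<dots> = (\<Sum>t\<in>preim u. weight G t (Var q))"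
  proof (rule sum.cong)
    fix t :: "('f, 'q) tree" assume "t \<in> preim u"
    then have "vars t = {}" using vars_trees by (auto simp: preimage_def)
    moreover have "{p \<in> productions G. target p = q \<and> fulfils t p} = ?P"
      using wta by (auto simp: is_wta_def fulfils_def)
    ultimately show "(\<Sum>p\<in>?P. wt G p * weight G t (lhs p)) = weight G t (Var q)"
      using weight_Var[OF G] by simp
  qed simp
  finally show ?case .
qed

lemma generates_image_grammar:
  assumes "u \<in> trees \<Delta> {}"
  shows "generates G' u = hom_image \<Sigma> h (generates G) u"
proof -
  have fin: "finite Q" using G by (simp add: is_wtgc_def)
  \<comment> \<open>The sink is a separate summand and vanishes because its final weight is
    0.\<close>
  have "0 \<notin> e ` Q" by auto
  then have "generates G' u = (\<Sum>n\<in>e ` Q. final G' n * weight G' u (Var n))"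
    using fin by (simp add: generates_eq_weight image_grammar_def)
  also have "\<dots> = (\<Sum>q\<in>Q. final G' (e q) * weight G' u (Var (e q)))"
    using e_inj by (simp add: sum.reindex)
  also have "\<dots> = (\<Sum>q\<in>Q. \<Sum>t\<in>preim u. final G q * weight G t (Var q))"
    using e_inj weight_image_grammar[OF assms]
    by (intro sum.cong) (auto simp: image_grammar_def sum_distrib_left)
  also have "\<dots> = hom_image \<Sigma> h (generates G) u"
    unfolding hom_image_def generates_eq_weight preimage_def by (rule sum.swap)
  finally show ?thesis .
qed

end

theorem theorem5:
  fixes \<Sigma> :: "'f ranked" and \<Delta> :: "'d ranked"
    and G :: "('q, 'f, 's :: {comm_semiring_0, comm_monoid_mult}) wtgc"
    and h :: "'f \<Rightarrow> ('d, nat) tree"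
  assumes "ranked_alphabet \<Sigma>" and "ranked_alphabet \<Delta>"
    and "is_wta G" and "alphabet G = \<Sigma>"
    and "tree_hom \<Sigma> \<Delta> h" and "nondeleting \<Sigma> h" and "nonerasing \<Sigma> h"
  shows "\<exists>G' :: (nat, 'd, 's) wtgc.
    is_wtgc G' \<and> alphabet G' = \<Delta> \<and> eq_restricted G' \<and> positive G' \<and> classic G' \<and>
    (\<forall>u\<in>trees \<Delta> {}. generates G' u = hom_image \<Sigma> h (generates G) u)"
proof -
  have "finite (nonterminals G)" using assms(3) by (simp add: is_wta_def is_wtgc_def)
  then obtain e0 :: "'q \<Rightarrow> nat" where "inj_on e0 (nonterminals G)"
    using finite_imp_inj_to_nat_seg by metis
  \<comment> \<open>\<open>Suc\<close> keeps the codes of the nonterminals away from the sink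
    \<open>0\<close>.\<close>
  then interpret hom_wta \<Delta> G h "\<lambda>q. Suc (e0 q)"
    using assms by unfold_locales (auto simp: inj_on_def)
  show ?thesis
    using is_wtgc_image_grammar eq_restricted_image_grammar positive_image_grammar
      classic_image_grammar generates_image_grammar assms(4)
    by (intro exI[of _ image_grammar]) (auto simp: image_grammar_def)
qed

end
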